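(* Let $k\ge 1$ and let $1\le s_1<s_2<\ldots<s_k$ be fixed integers with $\gcd(s_1,s_2,\ldots,s_k)=1$. For each integer $n\ge 1$ let $\tau(n)$ be the number of spanning trees in the circulant graph $C_{2n}(s_1,s_2,\ldots,s_k,n)$ of odd valency $2k+1$. Then the generating function $$F(x)=\sum_{n=1}^{\infty}\tau(n)x^n$$ is a rational function with integer coefficients. Moreover, $F(x)=F(1/x)$.
   Context: The circulant graph $C_{2n}(s_1,\ldots,s_k,n)$ of odd valency has vertex set $\mathbb{Z}_{2n}=\{0,1,\ldots,2n-1\}$, and the vertex $i$ is adjacent to the vertices $i\pm s_1,\ldots,i\pm s_k$ and $i+n \pmod{2n}$. When $s_k<n$ this is a simple $(2k+1)$-regular graph. For the finitely many small $n$ with $s_k\ge n$, it is understood as the multigraph having one edge joining $i$ and $i+s_j \pmod{2n}$ for each pair $(i,j)$ with $i\in\mathbb{Z}_{2n}$, $1\le j\le k$, together with one edge joining $i$ and $i+n$ for each $i=0,1,\ldots,n-1$ (so $2nk+n$ edges in total; loops and multiple edges are allowed, and parallel edges are distinguished when counting spanning trees). The graph is connected if and only if $\gcd(s_1,\ldots,s_k,n)=1$. "$F$ is a rational function with integer coefficients" means that the power series $F(x)$ is the expansion at $x=0$ of a quotient of two polynomials in $\mathbb{Z}[x]$; the identity $F(x)=F(1/x)$ is an identity of rational functions. *)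

theory Defs
  imports "HOL-Computational_Algebra.Computational_Algebra"
begin

section \<open>Undirected multigraphs and spanning trees\<close>

text \<open>
  Edges are named, so parallel edges are distinct objects. The ends of an edge form a set
  \<open>{u, v}\<close>; it is a singleton for a loop. (The trees of the session
  \<open>Graph_Theory\<close> forbid only directed cycles, so they do not fit undirected graphs.)
\<close>

record ('v, 'e) multigraph =
  verts :: "'v set"
  edges :: "'e set"
  ends :: "'e \<Rightarrow> 'v set"

definition adj :: "('v, 'e) multigraph \<Rightarrow> ('v \<times> 'v) set" where
  "adj G = {(u, v). \<exists>e \<in> edges G. ends G e = {u, v}}"

definition mg_connected :: "('v, 'e) multigraph \<Rightarrow> bool" where
  "mg_connected G \<longleftrightarrow> verts G \<noteq> {} \<and> (\<forall>u \<in> verts G. \<forall>v \<in> verts G. (u, v) \<in> (adj G)\<^sup>*)"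

text \<open>
  A cycle visits the distinct vertices \<open>vs\<close> in cyclic order along the distinct edges \<open>es\<close>.
  Length 1 is a loop, length 2 a pair of parallel edges.
\<close>

definition mg_cycle :: "('v, 'e) multigraph \<Rightarrow> 'v list \<Rightarrow> 'e list \<Rightarrow> bool" where
  "mg_cycle G vs es \<longleftrightarrow>
     es \<noteq> [] \<and> length vs = length es \<and> distinct vs \<and> distinct es \<and>
     set vs \<subseteq> verts G \<and> set es \<subseteq> edges G \<and>
     (\<forall>i < length es. ends G (es ! i) = {vs ! i, vs ! (Suc i mod length es)})"

definition mg_tree :: "('v, 'e) multigraph \<Rightarrow> bool" where
  "mg_tree G \<longleftrightarrow> mg_connected G \<and> (\<nexists>vs es. mg_cycle G vs es)"

text \<open>A spanning subgraph keeps all vertices, so it is identified with its edge set.\<close>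

definition spanning_trees :: "('v, 'e) multigraph \<Rightarrow> 'e set set" where
  "spanning_trees G = {T. T \<subseteq> edges G \<and> mg_tree (G\<lparr>edges := T\<rparr>)}"


section \<open>Circulant graphs of odd valency\<close>

text \<open>
  The graph \<open>C\<^bsub>2n\<^esub>(s 1, \<dots>, s k, n)\<close>, with vertices \<open>{0..<2n}\<close> standing for the integers
  modulo \<open>2n\<close>. The edge \<open>Inl (i, j)\<close> joins \<open>i\<close> to \<open>i + s j\<close>; each of the \<open>n\<close> edges
  \<open>Inr i\<close> joins two antipodal vertices. No bound \<open>s k < n\<close> is imposed.
\<close>

definition circulant_odd ::
    "nat \<Rightarrow> (nat \<Rightarrow> nat) \<Rightarrow> nat \<Rightarrow> (nat, nat \<times> nat + nat) multigraph" where
  "circulant_odd k s n =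
     \<lparr>verts = {0..<2 * n},
      edges = ({0..<2 * n} \<times> {1..k}) <+> {0..<n},
      ends = (\<lambda>e. case e of Inl (i, j) \<Rightarrow> {i, (i + s j) mod (2 * n)} | Inr i \<Rightarrow> {i, i + n})\<rparr>"

definition tau :: "nat \<Rightarrow> (nat \<Rightarrow> nat) \<Rightarrow> nat \<Rightarrow> nat" where
  "tau k s n = card (spanning_trees (circulant_odd k s n))"

definition tau_gf :: "nat \<Rightarrow> (nat \<Rightarrow> nat) \<Rightarrow> rat fps" where
  "tau_gf k s = Abs_fps (\<lambda>n. if n = 0 then 0 else of_nat (tau k s n))"


section \<open>Rational functions over the integers\<close>

text \<open>
  Rational functions are elements of the fraction field of \<open>int poly\<close>. The value
  \<open>P(r) / Q(r)\<close> of the rational function \<open>P / Q\<close> is taken at an element \<open>r\<close> of that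
  field, so that \<open>r = 1 / ratfun_X\<close> substitutes \<open>1/x\<close> for the indeterminate.
\<close>

definition ratfun_X :: "int poly fract" where
  "ratfun_X = Fract [:0, 1:] 1"

definition ratfun_at :: "int poly \<Rightarrow> int poly \<Rightarrow> int poly fract \<Rightarrow> int poly fract" where
  "ratfun_at P Q r = poly (map_poly of_int P) r / poly (map_poly of_int Q) r"

text \<open>For \<open>Q(0) \<noteq> 0\<close>, the power series of \<open>P / Q\<close> at \<open>x = 0\<close>.\<close>

definition expansion_at_0 :: "int poly \<Rightarrow> int poly \<Rightarrow> rat fps" where
  "expansion_at_0 P Q = fps_of_poly (map_poly of_int P) / fps_of_poly (map_poly of_int Q)"

end

theory Submission
  imports Defs "Jordan_Normal_Form.Char_Poly"
begin

text \<open>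
  The number of spanning trees is first brought into a closed form. By the matrix-tree theorem
  (\<open>matrix_tree\<close>) it is a reduced determinant of the Laplacian, and since the Laplacian of a circulant
  graph is diagonalised by the characters of the cyclic group, it is \<open>1 / (2 * n)\<close> times the product of the
  eigenvalues at the roots of unity \<open>z \<noteq> 1\<close> of order \<open>2 * n\<close> (\<open>tau_eigenvalue_prod\<close>). The eigenvalue at \<open>z\<close> is
  a Laurent polynomial in \<open>z\<close> that depends on \<open>n\<close> only through the sign \<open>z ^ n\<close>. Products of a fixed
  polynomial over all \<open>z\<close> with \<open>z ^ n = 1\<close> or with \<open>z ^ n = - 1\<close> are products of \<open>a ^ n - 1\<close> or \<open>b ^ n + 1\<close> over
  its roots. The double zero of the first polynomial at 1 contributes \<open>n\<^sup>2\<close>, and what results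
  (\<open>tau_closed_form\<close>) is \<open>C * n\<close> times a product of factors \<open>u i ^ n + \<epsilon> i\<close> with signs \<open>\<epsilon> i\<close>, where all \<open>u i\<close>
  multiply to 1 and all \<open>\<epsilon> i\<close> multiply to 1.

  Such a sequence is \<open>n\<close> times a combination of powers \<open>l ^ n\<close>, so its generating function is a
  combination of the fractions \<open>l * x / (1 - l * x)\<^sup>2\<close>. Replacing \<open>x\<close> by \<open>1 / x\<close> amounts to replacing each \<open>l\<close> by its
  inverse, and the set of the \<open>l\<close>, with coefficients, is invariant under inversion
  (\<open>signed_power_prod_gf\<close>).

  This gives a quotient of complex polynomials. Its power series has rational coefficients, so a
  \<open>\<rat>\<close>-linear projection from the complex to the rational numbers yields a quotient of rational
  polynomials for the same series (\<open>rational_series_descent\<close>), and denominators can be cleared. The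
  symmetry, being an identity between values at almost all complex numbers, is inherited.

  The matrix-tree theorem itself is proved without the Cauchy-Binet formula: the reduced determinant is
  expanded over all ways to choose an edge at every vertex except the root. Such a choice contributes 1
  if following the chosen edges always leads to the root, and 0 otherwise, and the choices of the first
  kind correspond to the spanning trees.
\<close>

section \<open>Spanning trees as parent maps\<close>

definition opposite :: "'v set \<Rightarrow> 'v \<Rightarrow> 'v" where
  "opposite A v = (THE u. A = {v, u})"

lemma opposite_pair [simp]: "opposite {v, u} v = u" "opposite {u, v} v = u"
  unfolding opposite_def by (rule the_equality; force simp: doubleton_eq_iff)+

text \<open>
  The definition of a multigraph leaves the sets of ends arbitrary; every argument about walks and
  about the Laplacian needs them to be one or two vertices of the graph.
\<close>

definition pairs_edges :: "('v, 'e) multigraph \<Rightarrow> bool" where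
  "pairs_edges G \<longleftrightarrow> (\<forall>e\<in>edges G. \<exists>u\<in>verts G. \<exists>v\<in>verts G. ends G e = {u, v})"

text \<open>
  On a finite set \<open>U\<close> this says that iterating \<open>p\<close> leaves \<open>U\<close> from every starting point. Put as the
  absence of a nonempty closed subset (a trap), it is used without any iteration: to refute something, one
  exhibits the set of offending vertices and checks that \<open>p\<close> maps it into itself.
\<close>

definition no_trap :: "'v set \<Rightarrow> ('v \<Rightarrow> 'v) \<Rightarrow> bool" where
  "no_trap U p \<longleftrightarrow> (\<forall>C\<subseteq>U. p ` C \<subseteq> C \<longrightarrow> C = {})"

text \<open>
  Every vertex \<open>v\<close> except the root names an edge \<open>f v\<close> at \<open>v\<close>; following these edges must lead to
  the root. The other end of \<open>f v\<close> is the parent of \<open>v\<close>.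
\<close>

definition parent_maps :: "('v, 'e) multigraph \<Rightarrow> 'v \<Rightarrow> ('v \<Rightarrow> 'e) set" where
  "parent_maps G r = {f \<in> (verts G - {r}) \<rightarrow>\<^sub>E edges G.
     (\<forall>v\<in>verts G - {r}. v \<in> ends G (f v)) \<and>
     no_trap (verts G - {r}) (\<lambda>v. opposite (ends G (f v)) v)}"

lemma ends_subset_verts: "pairs_edges G \<Longrightarrow> e \<in> edges G \<Longrightarrow> ends G e \<subseteq> verts G"
  unfolding pairs_edges_def by fastforce

lemma ends_opposite:
  assumes "pairs_edges G" "e \<in> edges G" "v \<in> ends G e"
  shows "ends G e = {v, opposite (ends G e) v}" "opposite (ends G e) v \<in> verts G"
proof -
  obtain a b where ab: "ends G e = {a, b}" "a \<in> verts G" "b \<in> verts G"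
    using assms unfolding pairs_edges_def by blast
  from assms(3) consider "v = a" | "v = b" unfolding ab(1) by blast
  then have "ends G e = {v, opposite (ends G e) v} \<and> opposite (ends G e) v \<in> verts G"
    by cases (simp_all add: ab insert_commute)
  then show "ends G e = {v, opposite (ends G e) v}" "opposite (ends G e) v \<in> verts G"
    by (blast, blast)
qed

lemma opposite_in_ends:
  assumes "pairs_edges G" "e \<in> edges G" "v \<in> ends G e"
  shows "opposite (ends G e) v \<in> ends G e"
  by (rule subsetD[OF equalityD2[OF ends_opposite(1)[OF assms]]]) simp

lemma ends_eq_pair:
  assumes "pairs_edges G" "e \<in> edges G" "v \<in> ends G e" "w \<in> ends G e" "v \<noteq> w"
  shows "ends G e = {v, w}"
proof -
  obtain a b where "ends G e = {a, b}" using assms(1,2) unfolding pairs_edges_def by blast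
  with assms(3-5) show ?thesis by (auto simp: insert_commute)
qed

lemma no_trapD: "no_trap U p \<Longrightarrow> C \<subseteq> U \<Longrightarrow> (\<And>v. v \<in> C \<Longrightarrow> p v \<in> C) \<Longrightarrow> C = {}"
  unfolding no_trap_def by blast

lemma sym_adj: "sym (adj G)"
  by (rule symI) (simp add: adj_def insert_commute)

text \<open>
  Along the transitive closure a path is extended edge by edge; when the new vertex already lies on
  it, the path is cut back to that vertex, so vertices never repeat.
\<close>

lemma simple_path_exists:
  assumes "(a, b) \<in> (adj H)\<^sup>*" "a \<in> verts H" "pairs_edges H"
  shows "\<exists>vs es. vs \<noteq> [] \<and> hd vs = a \<and> last vs = b \<and> distinct vs \<and> set vs \<subseteq> verts H \<and>
           length vs = Suc (length es) \<and> set es \<subseteq> edges H \<and>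
           (\<forall>i<length es. ends H (es ! i) = {vs ! i, vs ! Suc i})"
  using assms(1)
proof (induction rule: rtrancl_induct)
  case base
  show ?case using assms(2) by (intro exI[of _ "[a]"] exI[of _ "[]"]) auto
next
  case (step y z)
  from step.IH obtain vs es where IH: "vs \<noteq> []" "hd vs = a" "last vs = y" "distinct vs"
    "set vs \<subseteq> verts H" "length vs = Suc (length es)" "set es \<subseteq> edges H"
    "\<forall>i<length es. ends H (es ! i) = {vs ! i, vs ! Suc i}" by blast
  from step.hyps(2) obtain e where e: "e \<in> edges H" "ends H e = {y, z}"
    by (auto simp: adj_def)
  then have z: "z \<in> verts H"
    using ends_subset_verts[OF assms(3) e(1)] by simp
  show ?case
  proof (cases "z \<in> set vs")
    case True
    then obtain j where j: "j < length vs" "vs ! j = z" by (auto simp: in_set_conv_nth)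
    have "last (take (Suc j) vs) = z"
      using j by (simp add: take_Suc_conv_app_nth)
    moreover have "set (take (Suc j) vs) \<subseteq> verts H" "set (take j es) \<subseteq> edges H"
      using IH set_take_subset by fast+
    ultimately show ?thesis using IH j
      by (intro exI[of _ "take (Suc j) vs"] exI[of _ "take j es"])
         (auto simp: hd_take)
  next
    case False
    have "ends H ((es @ [e]) ! i) = {(vs @ [z]) ! i, (vs @ [z]) ! Suc i}"
      if "i < Suc (length es)" for i
    proof (cases "i < length es")
      case True
      then show ?thesis using IH by (simp add: nth_append)
    next
      case False
      then have "i = length es" using that by simp
      moreover have "vs ! length es = y" using IH(1,3,6) by (simp add: last_conv_nth)
      ultimately show ?thesis using IH e by (simp add: nth_append)
    qed
    then show ?thesis using IH e z False
      by (intro exI[of _ "vs @ [z]"] exI[of _ "es @ [e]"]) auto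
  qed
qed

text \<open>
  A simple path avoiding \<open>e\<close> between the ends of \<open>e\<close> is closed up by \<open>e\<close>. The edges of the path are
  distinct because its vertices are. For a loop \<open>e\<close> the path has one vertex and no edge.
\<close>

lemma cycle_from_connection:
  assumes "(a, b) \<in> (adj (G\<lparr>edges := S\<rparr>))\<^sup>*" "S \<subseteq> edges G" "pairs_edges G"
    and "e \<in> edges G - S" "ends G e = {a, b}"
  shows "\<exists>vs es. mg_cycle G vs es"
proof -
  have "a \<in> verts G" using ends_subset_verts[OF assms(3), of e] assms(4,5) by simp
  moreover have "pairs_edges (G\<lparr>edges := S\<rparr>)"
    using assms(2,3) unfolding pairs_edges_def by auto
  ultimately obtain vs es where p: "vs \<noteq> []" "hd vs = a" "last vs = b" "distinct vs"
    "set vs \<subseteq> verts G" "length vs = Suc (length es)" "set es \<subseteq> S"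
    "\<And>i. i < length es \<Longrightarrow> ends G (es ! i) = {vs ! i, vs ! Suc i}"
    using simple_path_exists[OF assms(1)] by auto
  have "es ! i \<noteq> es ! j" if "i < j" "j < length es" for i j
  proof
    assume "es ! i = es ! j"
    then have "vs ! i \<in> {vs ! j, vs ! Suc j}" using p(8)[of i] p(8)[of j] that by auto
    then show False using that p(4,6) by (auto simp: nth_eq_iff_index_eq)
  qed
  then have "distinct es" unfolding distinct_conv_nth
    by (intro allI impI) (metis linorder_neqE_nat)
  moreover have "ends G ((es @ [e]) ! i) = {vs ! i, vs ! (Suc i mod Suc (length es))}"
    if "i < Suc (length es)" for i
  proof (cases "i < length es")
    case True
    then show ?thesis using p(8) by (simp add: nth_append)
  next
    case False
    then have "i = length es" using that by simp
    moreover have "vs ! length es = b" "vs ! 0 = a"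
      using p(1-3,6) by (simp_all add: last_conv_nth hd_conv_nth)
    ultimately show ?thesis using assms(5) by (simp add: insert_commute)
  qed
  ultimately have "mg_cycle G vs (es @ [e])"
    unfolding mg_cycle_def using p assms(2,4) by auto
  then show ?thesis by blast
qed

lemma parent_mapsD:
  assumes "f \<in> parent_maps G r"
  shows "v \<in> verts G - {r} \<Longrightarrow> f v \<in> edges G"
    and "v \<in> verts G - {r} \<Longrightarrow> v \<in> ends G (f v)"
    and "no_trap (verts G - {r}) (\<lambda>v. opposite (ends G (f v)) v)"
proof -
  have f: "f \<in> (verts G - {r}) \<rightarrow>\<^sub>E edges G" "\<forall>v\<in>verts G - {r}. v \<in> ends G (f v)"
    "no_trap (verts G - {r}) (\<lambda>v. opposite (ends G (f v)) v)"
    using assms unfolding parent_maps_def by simp_all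
  show "v \<in> verts G - {r} \<Longrightarrow> f v \<in> edges G" by (rule PiE_mem[OF f(1)])
  show "v \<in> verts G - {r} \<Longrightarrow> v \<in> ends G (f v)" using f(2) by simp
  show "no_trap (verts G - {r}) (\<lambda>v. opposite (ends G (f v)) v)" by (rule f(3))
qed

text \<open>
  If \<open>v\<close> and \<open>w\<close> shared a parent edge, they would be each other's parents and form a trap.
\<close>

lemma parent_maps_inj_on:
  assumes G: "pairs_edges G" and f: "f \<in> parent_maps G r"
  shows "inj_on f (verts G - {r})"
proof (rule inj_onI, rule ccontr)
  fix v w assume v: "v \<in> verts G - {r}" and w: "w \<in> verts G - {r}"
    and eq: "f v = f w" and "v \<noteq> w"
  have "w \<in> ends G (f v)" unfolding eq by (rule parent_mapsD(2)[OF f w])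
  from ends_eq_pair[OF G parent_mapsD(1,2)[OF f v] this \<open>v \<noteq> w\<close>]
  have e: "ends G (f v) = {v, w}" .
  have e': "ends G (f w) = {v, w}" using e unfolding eq .
  have "opposite (ends G (f v)) v = w" unfolding e by (rule opposite_pair)
  moreover have "opposite (ends G (f w)) w = v" unfolding e' by (rule opposite_pair)
  ultimately have "opposite (ends G (f x)) x \<in> {v, w}" if "x \<in> {v, w}" for x
    using that by (elim insertE) simp_all
  moreover have "{v, w} \<subseteq> verts G - {r}" using v w by (intro insert_subsetI empty_subsetI)
  ultimately have "{v, w} = {}" by (intro no_trapD[OF parent_mapsD(3)[OF f], of "{v, w}"])
  then show False by (rule insert_not_empty[THEN notE])
qed

text \<open>
  Both halves of being a tree are refutations by traps. The vertices not connected to the root are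
  closed under taking parents, and so are the vertices of a cycle.
\<close>

lemma parent_map_image_spanning_tree:
  assumes G: "pairs_edges G" and r: "r \<in> verts G" and f: "f \<in> parent_maps G r"
  shows "f ` (verts G - {r}) \<in> spanning_trees G"
proof -
  let ?U = "verts G - {r}"
  let ?p = "\<lambda>v. opposite (ends G (f v)) v"
  let ?H = "G\<lparr>edges := f ` ?U\<rparr>"
  have fE: "f v \<in> edges G" "v \<in> ends G (f v)" if "v \<in> ?U" for v
    using parent_mapsD(1,2)[OF f that] .
  have nt: "no_trap ?U ?p" by (rule parent_mapsD(3)[OF f])
  have p: "ends G (f v) = {v, ?p v}" "?p v \<in> verts G" if "v \<in> ?U" for v
    using ends_opposite[OF G] fE[OF that] by blast+
  have step: "(v, ?p v) \<in> adj ?H" if "v \<in> ?U" for v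
    unfolding adj_def using that
    by (intro CollectI case_prodI bexI[of _ "f v"]) (simp add: p(1)[OF that, symmetric], simp)
  have "{v \<in> ?U. (v, r) \<notin> (adj ?H)\<^sup>*} = {}"
  proof (rule no_trapD[OF nt])
    fix v assume v: "v \<in> {v \<in> ?U. (v, r) \<notin> (adj ?H)\<^sup>*}"
    then have "(?p v, r) \<notin> (adj ?H)\<^sup>*"
      using converse_rtrancl_into_rtrancl[OF step, of v r] by blast
    then show "?p v \<in> {v \<in> ?U. (v, r) \<notin> (adj ?H)\<^sup>*}"
      using v p(2)[of v] by (cases "?p v = r") simp_all
  qed auto
  then have to_root: "(v, r) \<in> (adj ?H)\<^sup>*" if "v \<in> verts G" for v
    using that by (cases "v = r") auto
  have "mg_connected ?H"
    unfolding mg_connected_def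
  proof (intro conjI ballI)
    fix u v assume "u \<in> verts ?H" "v \<in> verts ?H"
    then have "(u, r) \<in> (adj ?H)\<^sup>*" "(v, r) \<in> (adj ?H)\<^sup>*" using to_root by simp_all
    then show "(u, v) \<in> (adj ?H)\<^sup>*"
      by (meson rtrancl_trans symD sym_adj sym_rtrancl)
  qed (use r in auto)
  moreover have False if "mg_cycle ?H vs es" for vs es
  proof -
    from that have c: "es \<noteq> []" "length vs = length es" "distinct vs" "distinct es"
      "set vs \<subseteq> verts G" "set es \<subseteq> f ` ?U"
      "\<And>i. i < length es \<Longrightarrow> ends G (es ! i) = {vs ! i, vs ! (Suc i mod length es)}"
      unfolding mg_cycle_def by auto
    \<comment> \<open>Each edge of the cycle is the parent edge of one of its ends. Different edges belong to
        different vertices, so by counting these owners are all the vertices of the cycle.\<close>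
    define g where "g = inv_into ?U f"
    have g: "g e \<in> ?U" "f (g e) = e" if "e \<in> set es" for e
      using inv_into_into[of e f ?U] f_inv_into_f[of e f ?U] that c(6) unfolding g_def by blast+
    have ends_vs: "ends G e \<subseteq> set vs" if "e \<in> set es" for e
    proof -
      obtain i where "i < length es" "e = es ! i" using \<open>e \<in> set es\<close> by (auto simp: in_set_conv_nth)
      moreover have "Suc i mod length es < length vs" using c(1,2) by simp
      ultimately show ?thesis using c(2) c(7)[of i] by simp
    qed
    have "g ` set es \<subseteq> set vs"
    proof
      fix v assume "v \<in> g ` set es"
      then obtain e where "e \<in> set es" "v = g e" by auto
      then show "v \<in> set vs" using g[of e] ends_vs[of e] fE(2)[of "g e"] by auto
    qed
    moreover have "inj_on g (set es)" using g by (metis inj_onI)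
    then have "card (g ` set es) = card (set vs)"
      using c by (simp add: card_image distinct_card)
    ultimately have gv: "g ` set es = set vs" by (simp add: card_subset_eq)
    have "set vs = {}"
    proof (rule no_trapD[OF nt])
      have "g ` set es \<subseteq> ?U" using g(1) by (rule image_subsetI)
      then show "set vs \<subseteq> ?U" by (simp only: gv)
      fix v assume "v \<in> set vs"
      then have "v \<in> g ` set es" by (simp only: gv)
      then obtain e where e: "e \<in> set es" "v = g e" by (rule imageE) (rule that)
      have "?p v \<in> ends G (f v)"
        unfolding e(2) by (rule opposite_in_ends[OF G fE[OF g(1)[OF e(1)]]])
      then have "?p v \<in> ends G e" unfolding e(2) g(2)[OF e(1)] .
      then show "?p v \<in> set vs" by (rule subsetD[OF ends_vs[OF e(1)]])
    qed
    then show False using c(1,2) by simp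
  qed
  ultimately have "mg_tree ?H" unfolding mg_tree_def by blast
  moreover have "f ` ?U \<subseteq> edges G" using fE by auto
  ultimately show ?thesis unfolding spanning_trees_def by simp
qed

text \<open>
  Where two parent maps with the same edges differ at \<open>v\<close>, the edge \<open>g v\<close> is the \<open>f\<close>-parent edge of
  its other end \<open>w\<close>, so they also differ at \<open>w\<close>, the \<open>g\<close>-parent of \<open>v\<close>. The vertices where they differ
  thus form a trap for \<open>g\<close>.
\<close>

lemma parent_map_image_inj:
  assumes G: "pairs_edges G" 
  shows "inj_on (\<lambda>f. f ` (verts G - {r})) (parent_maps G r)"
proof (rule inj_onI)
  fix f g assume f: "f \<in> parent_maps G r" and g: "g \<in> parent_maps G r"
    and eq: "f ` (verts G - {r}) = g ` (verts G - {r})"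
  let ?U = "verts G - {r}"
  let ?D = "{v \<in> ?U. f v \<noteq> g v}"
  have f': "f v \<in> edges G" "v \<in> ends G (f v)" if "v \<in> ?U" for v
    using parent_mapsD(1,2)[OF f that] .
  have g': "g v \<in> edges G" "v \<in> ends G (g v)" if "v \<in> ?U" for v
    using parent_mapsD(1,2)[OF g that] .
  have "?D = {}"
  proof (rule no_trapD)
    show "no_trap ?U (\<lambda>v. opposite (ends G (g v)) v)" by (rule parent_mapsD(3)[OF g])
    fix v assume v: "v \<in> ?D"
    then obtain w where w: "w \<in> ?U" "g v = f w" using eq by blast
    have "w \<noteq> v" using v w(2) by auto
    have "w \<in> ends G (g v)" unfolding w(2) by (rule f'(2)[OF w(1)])
    then have e: "ends G (g v) = {v, w}"
      using ends_eq_pair[OF G g', of v w] v \<open>w \<noteq> v\<close> by simp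
    have "g w \<noteq> g v"
      using inj_onD[OF parent_maps_inj_on[OF G g], of w v] v w(1) \<open>w \<noteq> v\<close> by blast
    then have "w \<in> ?D" using w by simp
    then show "opposite (ends G (g v)) v \<in> ?D" unfolding e opposite_pair .
  qed auto
  then show "f = g"
    using f g unfolding parent_maps_def
    by (intro PiE_ext[of f ?U "\<lambda>_. edges G" g]) blast+
qed

text \<open>
  The parent edge of \<open>v\<close> is the first edge of a shortest walk to the root, measured by the distance
  \<open>d\<close>. The chosen edges already connect all vertices, so a further edge of the tree would close a
  cycle.
\<close>

lemma spanning_tree_parent_map:
  assumes G: "pairs_edges G" and r: "r \<in> verts G" and T: "T \<in> spanning_trees G"
  shows "\<exists>f\<in>parent_maps G r. f ` (verts G - {r}) = T"
proof -
  let ?U = "verts G - {r}"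
  let ?H = "G\<lparr>edges := T\<rparr>"
  from T have TE: "T \<subseteq> edges G" and conn: "mg_connected ?H" and acyc: "\<nexists>vs es. mg_cycle ?H vs es"
    unfolding spanning_trees_def mg_tree_def by auto
  define d where "d v = (LEAST n. (v, r) \<in> adj ?H ^^ n)" for v
  have "\<exists>e\<in>T. \<exists>u. ends G e = {v, u} \<and> d u < d v" if v: "v \<in> ?U" for v
  proof -
    have "(v, r) \<in> (adj ?H)\<^sup>*" using conn v r unfolding mg_connected_def by auto
    then obtain n where n: "(v, r) \<in> adj ?H ^^ n" by (auto simp: rtrancl_power)
    then have dv: "(v, r) \<in> adj ?H ^^ d v" unfolding d_def by (rule LeastI)
    show ?thesis
    proof (cases "d v")
      case 0
      with dv v show ?thesis by simp
    next
      case (Suc j)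
      with dv obtain u where u: "(v, u) \<in> adj ?H" "(u, r) \<in> adj ?H ^^ j"
        by (metis relpow_Suc_D2)
      from u(2) have "d u \<le> j" unfolding d_def by (rule Least_le)
      then have "d u < d v" using Suc by simp
      with u(1) show ?thesis unfolding adj_def by auto
    qed
  qed
  then obtain h where h: "\<And>v. v \<in> ?U \<Longrightarrow> h v \<in> T \<and> (\<exists>u. ends G (h v) = {v, u} \<and> d u < d v)"
    by metis
  define f where "f = restrict h ?U"
  let ?p = "\<lambda>v. opposite (ends G (f v)) v"
  have fT: "f v \<in> T" "v \<in> ends G (f v)" "d (?p v) < d v" if "v \<in> ?U" for v
    using h[OF that] that unfolding f_def by auto
  have "no_trap ?U ?p"
    unfolding no_trap_def
  proof (intro allI impI, rule ccontr)
    fix C assume C: "C \<subseteq> ?U" "?p ` C \<subseteq> C" "C \<noteq> {}"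
    then obtain v where v: "v \<in> C" "\<And>w. w \<in> C \<Longrightarrow> d v \<le> d w"
      using ex_has_least_nat[of "\<lambda>v. v \<in> C" _ d] by blast
    then have "v \<in> ?U" "?p v \<in> C" using C by auto
    then show False using fT(3)[of v] v(2)[of "?p v"] by auto
  qed
  then have f: "f \<in> parent_maps G r"
    unfolding parent_maps_def using fT TE by (auto simp: f_def)
  have conn': "mg_connected (G\<lparr>edges := f ` ?U\<rparr>)"
    using parent_map_image_spanning_tree[OF G r f] unfolding spanning_trees_def mg_tree_def by simp
  have sub: "f ` ?U \<subseteq> T" using fT by auto
  moreover have "T \<subseteq> f ` ?U"
  proof (rule ccontr)
    assume "\<not> T \<subseteq> f ` ?U"
    then obtain e where e: "e \<in> T - f ` ?U" by auto
    then obtain a b where ab: "a \<in> verts G" "b \<in> verts G" "ends G e = {a, b}"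
      using G TE unfolding pairs_edges_def by blast
    have H: "pairs_edges ?H" using G TE unfolding pairs_edges_def by auto
    have "(a, b) \<in> (adj (?H\<lparr>edges := f ` ?U\<rparr>))\<^sup>*"
      using conn' ab unfolding mg_connected_def by auto
    from cycle_from_connection[OF this _ H, of e] sub e ab acyc show False by auto
  qed
  ultimately show ?thesis using f by blast
qed

theorem bij_betw_parent_maps_spanning_trees:
  assumes "pairs_edges G" "r \<in> verts G"
  shows "bij_betw (\<lambda>f. f ` (verts G - {r})) (parent_maps G r) (spanning_trees G)"
  unfolding bij_betw_def
  using parent_map_image_inj[OF assms(1)] parent_map_image_spanning_tree[OF assms]
    spanning_tree_parent_map[OF assms] by (fastforce simp: image_iff)

section \<open>The matrix-tree theorem\<close>

text \<open>
  The contribution of one edge with set of ends \<open>A\<close> to row \<open>v\<close> of the Laplacian. It vanishes for a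
  loop, where the two terms cancel.
\<close>

definition edge_laplacian :: "'v set \<Rightarrow> 'v \<Rightarrow> 'v \<Rightarrow> 'a :: comm_ring_1" where
  "edge_laplacian A v w = (if v \<in> A then of_bool (w = v) - of_bool (w = opposite A v) else 0)"

definition laplacian :: "('v, 'e) multigraph \<Rightarrow> 'v \<Rightarrow> 'v \<Rightarrow> 'a :: comm_ring_1" where
  "laplacian G v w = (\<Sum>e\<in>edges G. edge_laplacian (ends G e) v w)"

text \<open>
  Identity minus the transition matrix of \<open>p\<close>, where \<open>p\<close> may leave the index range: values of \<open>p\<close>
  outside \<open>{0..<m}\<close> stand for the deleted root.
\<close>

definition pointer_matrix :: "nat \<Rightarrow> (nat \<Rightarrow> nat) \<Rightarrow> 'a :: comm_ring_1 mat" where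
  "pointer_matrix m p = mat m m (\<lambda>(v, w). of_bool (w = v) - of_bool (w = p v))"

text \<open>
  A permutation contributes to the Leibniz formula only if it fixes each index or moves it along
  \<open>p\<close>. The moved indices are then closed under \<open>p\<close>, so only the identity is left.
\<close>

lemma det_pointer_matrix_no_trap:
  assumes "no_trap {0..<m} p"
  shows "det (pointer_matrix m p :: 'a :: idom mat) = 1"
proof -
  have ne: "p v \<noteq> v" if "v < m" for v
    using no_trapD[OF assms, of "{v}"] that by auto
  have other: "(\<Prod>i = 0..<m. pointer_matrix m p $$ (i, \<sigma> i)) = (0 :: 'a)"
    if \<sigma>: "\<sigma> permutes {0..<m}" "\<sigma> \<noteq> id" for \<sigma>
  proof (rule ccontr)
    assume nz: "(\<Prod>i = 0..<m. pointer_matrix m p $$ (i, \<sigma> i)) \<noteq> (0 :: 'a)"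
    have lt: "\<sigma> i < m" if "i < m" for i using \<sigma>(1) that permutes_in_image[of \<sigma> "{0..<m}" i] by simp
    have "\<sigma> i = p i" if "i < m" "\<sigma> i \<noteq> i" for i
    proof (rule ccontr)
      assume "\<sigma> i \<noteq> p i"
      then have "pointer_matrix m p $$ (i, \<sigma> i) = (0 :: 'a)"
        using that lt[of i] unfolding pointer_matrix_def by simp
      then show False using nz that(1) by (metis (no_types, lifting) atLeastLessThan_iff finite_atLeastLessThan prod_zero zero_le)
    qed
    moreover have "\<sigma> (\<sigma> i) \<noteq> \<sigma> i" if "\<sigma> i \<noteq> i" for i
      using that permutes_inj[OF \<sigma>(1)] by (auto dest: injD)
    ultimately have "{i \<in> {0..<m}. \<sigma> i \<noteq> i} = {}"
      using lt by (intro no_trapD[OF assms]) force+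
    then have "\<sigma> i = i" for i using permutes_not_in[OF \<sigma>(1), of i] by auto
    then show False using \<sigma>(2) by (auto simp: fun_eq_iff)
  qed
  have C: "pointer_matrix m p \<in> carrier_mat m m" unfolding pointer_matrix_def by simp
  have "det (pointer_matrix m p :: 'a mat)
      = (\<Sum>\<sigma>\<in>{\<sigma>. \<sigma> permutes {0..<m}}. if \<sigma> = id then 1 else 0)"
    unfolding det_def'[OF C]
  proof (rule sum.cong)
    fix \<sigma> assume "\<sigma> \<in> {\<sigma>. \<sigma> permutes {0..<m}}"
    then show "signof \<sigma> * (\<Prod>i = 0..<m. pointer_matrix m p $$ (i, \<sigma> i)) = (if \<sigma> = id then 1 else (0 :: 'a))"
    proof (cases "\<sigma> = id")
      case True
      have "(\<Prod>i = 0..<m. pointer_matrix m p $$ (i, id i)) = (1 :: 'a)"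
        unfolding pointer_matrix_def by (intro prod.neutral) (use ne in fastforce)
      then show ?thesis using True by simp
    qed (use other \<open>\<sigma> \<in> _\<close> in auto)
  qed simp
  then show ?thesis by (simp add: finite_permutations permutes_id)
qed

text \<open>
  The indicator vector of the largest trap lies in the kernel: a row inside the trap has entries 1
  and -1 on it, and a row outside has none, since a vertex pointing into the trap belongs to it.
\<close>

lemma det_pointer_matrix_trap:
  assumes "\<not> no_trap {0..<m} p"
  shows "det (pointer_matrix m p :: 'a :: idom mat) = 0"
proof -
  define C where "C = \<Union>{B. B \<subseteq> {0..<m} \<and> p ` B \<subseteq> B}"
  have C: "C \<subseteq> {0..<m}" "p ` C \<subseteq> C" "C \<noteq> {}"
    using assms unfolding C_def no_trap_def by blast+
  have max: "v \<in> C" if "v < m" "p v \<in> C" for v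
  proof -
    have "insert v C \<subseteq> {0..<m} \<and> p ` insert v C \<subseteq> insert v C" using C that by auto
    then show ?thesis unfolding C_def by blast
  qed
  let ?x = "vec m (\<lambda>i. of_bool (i \<in> C)) :: 'a vec"
  have "pointer_matrix m p *\<^sub>v ?x = 0\<^sub>v m"
  proof (rule eq_vecI)
    fix v assume v: "v < dim_vec (0\<^sub>v m :: 'a vec)"
    have "vec_index (pointer_matrix m p *\<^sub>v ?x) v
        = (\<Sum>w = 0..<m. (of_bool (w = v) - of_bool (w = p v)) * of_bool (w \<in> C))"
      using v unfolding pointer_matrix_def by (simp add: scalar_prod_def)
    also have "\<dots> = (\<Sum>w = 0..<m. if w = v then of_bool (v \<in> C) else 0)
        - (\<Sum>w = 0..<m. if w = p v then of_bool (p v \<in> C) else 0)"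
      unfolding sum_subtractf[symmetric] by (rule sum.cong) auto
    also have "\<dots> = 0" using v C max[of v] by (auto simp: sum.delta)
    finally show "vec_index (pointer_matrix m p *\<^sub>v ?x) v = vec_index (0\<^sub>v m) v" using v by simp
  qed (simp add: pointer_matrix_def)
  moreover have "?x \<noteq> 0\<^sub>v m"
  proof
    assume eq: "?x = 0\<^sub>v m"
    obtain v where "v \<in> C" using C by auto
    moreover have "vec_index ?x v = vec_index (0\<^sub>v m) v" using eq by simp
    ultimately show False using C(1) by auto
  qed
  moreover have M: "pointer_matrix m p \<in> carrier_mat m m" and x: "?x \<in> carrier_vec m"
    unfolding pointer_matrix_def by simp_all
  ultimately show ?thesis
    unfolding det_0_iff_vec_prod_zero[OF M] by (intro exI[of _ ?x] conjI)
qed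

text \<open>
  Each row of the reduced Laplacian is a sum over the edges. Expanding the product in the Leibniz
  formula over all choices of one edge per row gives a sum of determinants. The matrix of a choice
  has a zero row unless every edge is chosen at its vertex, and otherwise it is a pointer matrix, with
  determinant 1 or 0 according to whether the choice is a parent map.
\<close>

theorem matrix_tree:
  fixes G :: "(nat, 'e) multigraph"
  assumes G: "pairs_edges G" and V: "verts G = {0..<Suc m}" and fin: "finite (edges G)"
  shows "det (mat m m (\<lambda>(v, w). laplacian G v w)) = (of_nat (card (spanning_trees G)) :: 'a :: idom)"
proof -
  let ?U = "{0..<m}"
  have U: "verts G - {m} = ?U" by (simp add: V atLeast0_lessThan_Suc)
  define B where "B f = (mat m m (\<lambda>(v, w). edge_laplacian (ends G (f v)) v w) :: 'a mat)" for f
  \<comment> \<open>If some \<open>f v\<close> is not an edge at \<open>v\<close>, row \<open>v\<close> vanishes; otherwise \<open>B f\<close> is a pointer matrix.\<close>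
  have detB: "det (B f) = of_bool (f \<in> parent_maps G m)" if f: "f \<in> ?U \<rightarrow>\<^sub>E edges G" for f
  proof (cases "\<forall>v\<in>?U. v \<in> ends G (f v)")
    case True
    have "B f = pointer_matrix m (\<lambda>v. opposite (ends G (f v)) v)"
      unfolding B_def pointer_matrix_def using True
      by (intro eq_matI) (auto simp: edge_laplacian_def)
    then show ?thesis
      using True f det_pointer_matrix_no_trap det_pointer_matrix_trap
      unfolding parent_maps_def U by (auto simp: of_bool_def)
  next
    case False
    then obtain v where v: "v < m" "v \<notin> ends G (f v)" by auto
    have "(\<Prod>i = 0..<m. B f $$ (i, \<sigma> i)) = 0" if "\<sigma> permutes ?U" for \<sigma>
    proof (rule prod_zero)
      have "\<sigma> v < m" using permutes_in_image[OF that, of v] v by simp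
      then show "\<exists>i\<in>{0..<m}. B f $$ (i, \<sigma> i) = 0"
        using v unfolding B_def edge_laplacian_def by (intro bexI[of _ v]) auto
    qed simp
    then have "det (B f) = 0"
      by (subst det_def'[of _ m]) (auto simp: B_def intro!: sum.neutral)
    then show ?thesis using False unfolding parent_maps_def U by auto
  qed
  have finU: "finite (?U \<rightarrow>\<^sub>E edges G)" using fin by (intro finite_PiE) auto
  have "det (mat m m (\<lambda>(v, w). laplacian G v w) :: 'a mat)
      = (\<Sum>\<sigma>\<in>{\<sigma>. \<sigma> permutes ?U}. signof \<sigma> * (\<Prod>i\<in>?U. \<Sum>e\<in>edges G. edge_laplacian (ends G e) i (\<sigma> i)))"
    by (subst det_def'[of _ m])
       (auto intro!: sum.cong prod.cong simp: laplacian_def permutes_in_image)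
  also have "\<dots> = (\<Sum>\<sigma>\<in>{\<sigma>. \<sigma> permutes ?U}. \<Sum>f\<in>?U \<rightarrow>\<^sub>E edges G.
        signof \<sigma> * (\<Prod>i\<in>?U. edge_laplacian (ends G (f i)) i (\<sigma> i)))"
    using fin by (subst prod_sum_PiE) (auto simp: sum_distrib_left)
  also have "\<dots> = (\<Sum>f\<in>?U \<rightarrow>\<^sub>E edges G. det (B f))"
    by (subst sum.swap, rule sum.cong[OF refl], subst det_def'[of _ m])
       (auto intro!: sum.cong prod.cong simp: B_def permutes_in_image)
  also have "\<dots> = (\<Sum>f\<in>?U \<rightarrow>\<^sub>E edges G. of_bool (f \<in> parent_maps G m))"
    using detB by (rule sum.cong[OF refl])
  finally have det: "det (mat m m (\<lambda>(v, w). laplacian G v w) :: 'a mat)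
      = (\<Sum>f\<in>?U \<rightarrow>\<^sub>E edges G. of_bool (f \<in> parent_maps G m))" .
  have count: "(\<Sum>f\<in>?U \<rightarrow>\<^sub>E edges G. of_bool (f \<in> parent_maps G m)) = (of_nat (card (parent_maps G m)) :: 'a)"
  proof -
    have "parent_maps G m \<subseteq> ?U \<rightarrow>\<^sub>E edges G"
      unfolding parent_maps_def U by (rule Collect_subset)
    then have "(?U \<rightarrow>\<^sub>E edges G) \<inter> {f. f \<in> parent_maps G m} = parent_maps G m"
      unfolding Collect_mem_eq by (rule Int_absorb1)
    then show ?thesis using finU by simp
  qed
  have "m \<in> verts G" by (simp add: V)
  from bij_betw_same_card[OF bij_betw_parent_maps_spanning_trees[OF G this]]
  have "card (parent_maps G m) = card (spanning_trees G)" .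
  then show ?thesis unfolding det count by simp
qed

section \<open>From the reduced determinant to a product of eigenvalues\<close>

text \<open>
  Adding the all-ones matrix keeps the reduced determinant visible in a full determinant, although
  \<open>det A\<close> itself is zero. In \<open>W * (U * M) * Y\<close> below, \<open>U\<close> adds all rows to the last one, which
  becomes constantly \<open>N\<close>; \<open>W\<close> uses it to remove the ones from the other rows; \<open>Y\<close> adds all columns
  to the last one, which clears it except for the corner entry \<open>N\<^sup>2\<close>.
\<close>

lemma det_add_ones_matrix:
  fixes A :: "nat \<Rightarrow> nat \<Rightarrow> 'a :: field_char_0"
  assumes row: "\<And>i. i < Suc m \<Longrightarrow> (\<Sum>j = 0..<Suc m. A i j) = 0"
    and col: "\<And>j. j < Suc m \<Longrightarrow> (\<Sum>i = 0..<Suc m. A i j) = 0"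
  shows "det (mat (Suc m) (Suc m) (\<lambda>(i, j). A i j + 1))
       = of_nat (Suc m) ^ 2 * det (mat m m (\<lambda>(i, j). A i j))"
proof -
  define N :: 'a where "N = of_nat (Suc m)"
  have N0: "N \<noteq> 0" unfolding N_def by (rule of_nat_neq_0)
  let ?n = "Suc m"
  let ?M = "mat ?n ?n (\<lambda>(i, j). A i j + 1)"
  let ?U = "mat ?n ?n (\<lambda>(i, j). if i = m then 1 else if j = i then 1 else (0 :: 'a))"
  let ?W = "mat ?n ?n (\<lambda>(i, j). (if j = i then 1 else 0) + (if j = m then if i = m then 0 else - 1 / N else 0))"
  let ?Y = "mat ?n ?n (\<lambda>(i, j). if j = m then 1 else if i = j then 1 else (0 :: 'a))"
  have detU: "det ?U = 1"
    by (subst det_lower_triangular[of ?n])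
       (auto simp: prod_list_diag_prod)
  have detW: "det ?W = 1"
    by (subst det_upper_triangular[of _ ?n])
       (auto simp: prod_list_diag_prod intro!: prod.neutral)
  have detY: "det ?Y = 1"
    by (subst det_upper_triangular[of _ ?n])
       (auto simp: prod_list_diag_prod intro!: prod.neutral)
  have "?U * ?M = mat ?n ?n (\<lambda>(i, j). if i = m then N else A i j + 1)" (is "_ = ?M1")
  proof (rule eq_matI)
    fix i j assume ij: "i < dim_row ?M1" "j < dim_col ?M1"
    have "(?U * ?M) $$ (i, j) = (\<Sum>k = 0..<?n. (if i = m then 1 else if k = i then 1 else 0) * (A k j + 1))"
      using ij by (simp add: scalar_prod_def del: sum.op_ivl_Suc)
    also have "\<dots> = (if i = m then N else A i j + 1)"
    proof (cases "i = m")
      case True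
      then show ?thesis using col[of j] ij by (simp add: sum.distrib N_def del: sum.op_ivl_Suc of_nat_Suc)
    next
      case False
      have "(\<Sum>k = 0..<?n. (if i = m then 1 else if k = i then 1 else 0) * (A k j + 1))
          = (\<Sum>k = 0..<?n. if k = i then A i j + 1 else 0)"
        using False by (intro sum.cong) auto
      then show ?thesis using False ij by (simp add: sum.delta del: sum.op_ivl_Suc)
    qed
    finally show "(?U * ?M) $$ (i, j) = ?M1 $$ (i, j)" using ij by simp
  qed simp_all
  moreover have "?W * ?M1 = mat ?n ?n (\<lambda>(i, j). if i = m then N else A i j)" (is "_ = ?M2")
  proof (rule eq_matI)
    fix i j assume ij: "i < dim_row ?M2" "j < dim_col ?M2"
    have "(?W * ?M1) $$ (i, j) = (\<Sum>k = 0..<?n. ((if k = i then 1 else 0) +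
        (if k = m then if i = m then 0 else - 1 / N else 0)) * (if k = m then N else A k j + 1))"
      using ij by (simp add: scalar_prod_def del: sum.op_ivl_Suc)
    also have "\<dots> = (\<Sum>k = 0..<?n. if k = i then (if i = m then N else A i j + 1) else 0)
         + (\<Sum>k = 0..<?n. if k = m then (if i = m then 0 else - 1) else 0)"
      unfolding sum.distrib[symmetric] using N0 by (intro sum.cong) (auto simp: field_simps)
    also have "\<dots> = (if i = m then N else A i j)"
      using ij by (simp add: sum.delta del: sum.op_ivl_Suc)
    finally show "(?W * ?M1) $$ (i, j) = ?M2 $$ (i, j)" using ij by simp
  qed simp_all
  moreover have "?M2 * ?Y = four_block_mat (mat m m (\<lambda>(i, j). A i j)) (0\<^sub>m m 1)
      (mat 1 m (\<lambda>_. N)) (mat 1 1 (\<lambda>_. N ^ 2))" (is "_ = ?K")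
  proof (rule eq_matI)
    fix i j assume "i < dim_row ?K" "j < dim_col ?K"
    then have ij: "i < ?n" "j < ?n" by simp_all
    have "(?M2 * ?Y) $$ (i, j)
        = (\<Sum>k = 0..<?n. (if i = m then N else A i k) * (if j = m then 1 else if k = j then 1 else 0))"
      using ij by (simp add: scalar_prod_def del: sum.op_ivl_Suc)
    also have "\<dots> = (if j = m then if i = m then N * N else 0 else if i = m then N else A i j)"
    proof (cases "j = m")
      case True
      then show ?thesis using row[of i] ij
        by (cases "i = m") (simp_all add: N_def del: sum.op_ivl_Suc of_nat_Suc)
    next
      case False
      have "(\<Sum>k = 0..<?n. (if i = m then N else A i k) * (if j = m then 1 else if k = j then 1 else 0))
          = (\<Sum>k = 0..<?n. if k = j then (if i = m then N else A i j) else 0)"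
        using False by (intro sum.cong) auto
      then show ?thesis using False ij by (simp add: sum.delta del: sum.op_ivl_Suc)
    qed
    finally show "(?M2 * ?Y) $$ (i, j) = ?K $$ (i, j)"
      using ij by (simp add: power2_eq_square)
  qed simp_all
  ultimately have K: "?W * (?U * ?M) * ?Y = ?K" by simp
  have "det ?M = det ?W * (det ?U * det ?M) * det ?Y" using detU detW detY by simp
  also have "\<dots> = det (?W * (?U * ?M) * ?Y)"
    by (simp add: det_mult[of _ ?n] mult_carrier_mat[of _ ?n ?n _ ?n])
  also have "\<dots> = det (mat m m (\<lambda>(i, j). A i j)) * det (mat 1 1 (\<lambda>_. N ^ 2))"
    unfolding K by (rule det_four_block_mat_upper_right_zero_col) (rule mat_carrier refl)+
  also have "det (mat 1 1 (\<lambda>_. N ^ 2)) = N ^ 2"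
    by (subst det_upper_triangular[of _ 1]) (auto simp: diag_mat_def)
  finally show ?thesis by (simp add: N_def mult.commute)
qed

lemma sum_powers_root_of_unity:
  fixes q :: "'a :: field"
  assumes "q ^ N = 1" "q \<noteq> 1"
  shows "(\<Sum>j = 0..<N. q ^ j) = 0"
  using assms power_diff_1_eq[of q N] by (simp add: atLeast0LessThan)

text \<open>
  The Fourier matrix \<open>F\<close> diagonalises \<open>A\<close> plus the all-ones matrix. The latter only changes the
  eigenvalue of the constant vector, from \<open>\<Lambda> 1 = 0\<close> to \<open>N\<close>, so that the determinant is \<open>N\<close> times the
  product over the nontrivial roots of unity; comparing with the previous lemma cancels one factor \<open>N\<close>.
\<close>

lemma reduced_det_eq_eigenvalue_prod:
  fixes A :: "nat \<Rightarrow> nat \<Rightarrow> complex" and \<Lambda> :: "complex \<Rightarrow> complex"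
  assumes col: "\<And>j. j < Suc m \<Longrightarrow> (\<Sum>i = 0..<Suc m. A i j) = 0"
    and one: "\<Lambda> 1 = 0"
    and eigen: "\<And>z i. z ^ Suc m = 1 \<Longrightarrow> i < Suc m \<Longrightarrow> (\<Sum>j = 0..<Suc m. A i j * z ^ j) = \<Lambda> z * z ^ i"
  shows "of_nat (Suc m) * det (mat m m (\<lambda>(i, j). A i j)) = (\<Prod>z\<in>{z. z ^ Suc m = 1} - {1}. \<Lambda> z)"
proof -
  let ?n = "Suc m" and ?R = "{z :: complex. z ^ Suc m = 1}"
  define w where "w l = cis (2 * pi * real l / real ?n)" for l
  have bij: "bij_betw w {..<?n} ?R"
    unfolding w_def by (rule bij_betw_roots_unity) simp
  have w0: "w 0 = 1" unfolding w_def by simp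
  have wR: "w l ^ ?n = 1" if "l < ?n" for l using bij that unfolding bij_betw_def by auto
  have wne: "w l \<noteq> 0" for l unfolding w_def by simp
  have winj: "w l = w l' \<longleftrightarrow> l = l'" if "l < ?n" "l' < ?n" for l l'
    using bij that unfolding bij_betw_def inj_on_def by auto
  define F where "F = mat ?n ?n (\<lambda>(j, l). w l ^ j)"
  define E where "E = mat ?n ?n (\<lambda>(l, j). inverse (w l) ^ j)"
  define X where "X l = \<Lambda> (w l) + (if l = 0 then of_nat ?n else 0)" for l
  define D where "D = mat ?n ?n (\<lambda>(k, l). if k = l then X l else 0)"
  define M where "M = mat ?n ?n (\<lambda>(i, j). A i j + 1)"
  have car: "F \<in> carrier_mat ?n ?n" "E \<in> carrier_mat ?n ?n" "D \<in> carrier_mat ?n ?n" "M \<in> carrier_mat ?n ?n"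
    unfolding F_def E_def D_def M_def by simp_all
  have geo: "(\<Sum>j = 0..<?n. w l ^ j) = (if l = 0 then of_nat ?n else 0)" if "l < ?n" for l
  proof (cases "l = 0")
    case False
    then have "w l \<noteq> 1" using winj[of l 0] that w0 by simp
    then show ?thesis using sum_powers_root_of_unity[OF wR[OF that]] False by simp
  qed (simp add: w0 del: sum.op_ivl_Suc of_nat_Suc)
  have "E * F = of_nat ?n \<cdot>\<^sub>m 1\<^sub>m ?n"
  proof (rule eq_matI)
    fix l l' assume "l < dim_row (of_nat ?n \<cdot>\<^sub>m 1\<^sub>m ?n :: complex mat)" "l' < dim_col (of_nat ?n \<cdot>\<^sub>m 1\<^sub>m ?n :: complex mat)"
    then have l: "l < ?n" "l' < ?n" by simp_all
    let ?q = "w l' / w l"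
    have "(E * F) $$ (l, l') = (\<Sum>j = 0..<?n. inverse (w l) ^ j * w l' ^ j)"
      using l unfolding E_def F_def by (simp add: scalar_prod_def del: sum.op_ivl_Suc)
    also have "\<dots> = (\<Sum>j = 0..<?n. ?q ^ j)"
      by (intro sum.cong) (simp_all add: power_mult_distrib[symmetric] divide_inverse mult.commute)
    also have "\<dots> = (if l = l' then of_nat ?n else 0)"
    proof (cases "l = l'")
      case False
      then have "?q \<noteq> 1" using winj[OF l] wne[of l] by simp
      moreover have "?q ^ ?n = 1" using wR l by (simp only: power_divide) simp
      ultimately show ?thesis using sum_powers_root_of_unity[of ?q ?n] False by simp
    qed (simp add: wne del: sum.op_ivl_Suc of_nat_Suc)
    finally show "(E * F) $$ (l, l') = (of_nat ?n \<cdot>\<^sub>m 1\<^sub>m ?n) $$ (l, l')" using l by simp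
  qed (simp_all add: E_def F_def)
  then have "det E * det F = of_nat ?n ^ ?n"
    using det_mult[OF car(2,1)] by simp
  then have F0: "det F \<noteq> 0" by (metis mult_zero_right of_nat_neq_0 power_not_zero)
  have "M * F = F * D"
  proof (rule eq_matI)
    fix i l assume "i < dim_row (F * D)" "l < dim_col (F * D)"
    then have il: "i < ?n" "l < ?n" using car by simp_all
    have "(M * F) $$ (i, l) = (\<Sum>j = 0..<?n. (A i j + 1) * w l ^ j)"
      using il unfolding M_def F_def by (simp add: scalar_prod_def del: sum.op_ivl_Suc)
    also have "\<dots> = (\<Sum>j = 0..<?n. A i j * w l ^ j) + (\<Sum>j = 0..<?n. w l ^ j)"
      unfolding sum.distrib[symmetric] by (simp add: algebra_simps del: sum.op_ivl_Suc)
    also have "\<dots> = \<Lambda> (w l) * w l ^ i + (if l = 0 then of_nat ?n else 0)"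
      unfolding geo[OF il(2)] eigen[OF wR[OF il(2)] il(1)] ..
    also have "\<dots> = w l ^ i * X l"
      unfolding X_def by (simp add: w0 algebra_simps)
    also have "\<dots> = (\<Sum>k = 0..<?n. if k = l then w l ^ i * X l else 0)"
      using il by (simp add: sum.delta del: sum.op_ivl_Suc)
    also have "\<dots> = (\<Sum>k = 0..<?n. w k ^ i * (if k = l then X l else 0))"
      by (intro sum.cong) auto
    also have "\<dots> = (F * D) $$ (i, l)"
      using il unfolding D_def F_def by (simp add: scalar_prod_def del: sum.op_ivl_Suc)
    finally show "(M * F) $$ (i, l) = (F * D) $$ (i, l)" .
  qed (simp_all add: M_def F_def D_def)
  then have "det M * det F = det D * det F"
    using det_mult[OF car(4,1)] det_mult[OF car(1,3)] by (metis mult.commute)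
  then have "det M = det D" using mult_right_cancel[OF F0] by blast
  also have "det D = (\<Prod>l = 0..<?n. X l)"
    by (subst det_upper_triangular[of _ ?n])
       (auto simp: D_def prod_list_diag_prod simp del: prod.op_ivl_Suc intro!: prod.cong)
  also have "\<dots> = of_nat ?n * (\<Prod>l = Suc 0..<?n. \<Lambda> (w l))"
    by (subst prod.atLeast_Suc_lessThan) (simp_all add: w0 one X_def del: prod.op_ivl_Suc)
  also have "(\<Prod>l = Suc 0..<?n. \<Lambda> (w l)) = (\<Prod>z\<in>?R - {1}. \<Lambda> z)"
  proof (rule prod.reindex_bij_betw)
    have "{Suc 0..<?n} = {..<?n} - {0}" by auto
    then show "bij_betw w {Suc 0..<?n} (?R - {1})"
      using bij_betw_DiffI[OF bij, of "{0}" "{1}"] w0 by simp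
  qed
  finally have "det M = of_nat ?n * (\<Prod>z\<in>?R - {1}. \<Lambda> z)" .
  moreover have "det M = of_nat ?n ^ 2 * det (mat m m (\<lambda>(i, j). A i j))"
    unfolding M_def using eigen[of 1] one col by (intro det_add_ones_matrix) auto
  ultimately show ?thesis
    by (simp add: power2_eq_square del: of_nat_Suc)
qed

section \<open>The Laplacian spectrum of a circulant graph\<close>

lemma edge_laplacian_pair:
  "edge_laplacian {a, b} v w
     = (if v = a then of_bool (w = a) - of_bool (w = b) else 0)
     + (if v = b then of_bool (w = b) - of_bool (w = a) else (0 :: 'a :: comm_ring_1))"
  unfolding edge_laplacian_def by (auto simp: insert_commute)

lemma edge_laplacian_sym:
  "edge_laplacian {a, b} v w = (edge_laplacian {a, b} w v :: 'a :: comm_ring_1)"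
  unfolding edge_laplacian_pair by auto

lemma sum_edge_laplacian:
  fixes x :: "'v \<Rightarrow> 'a :: comm_ring_1"
  assumes "finite V" "a \<in> V" "b \<in> V"
  shows "(\<Sum>w\<in>V. edge_laplacian {a, b} v w * x w)
       = (if v = a then x a - x b else 0) + (if v = b then x b - x a else 0)"
proof -
  have "(\<Sum>w\<in>V. (of_bool (w = c) - of_bool (w = d)) * x w) = x c - x d" if "c \<in> V" "d \<in> V" for c d
  proof -
    have "(\<Sum>w\<in>V. (of_bool (w = c) - of_bool (w = d)) * x w)
        = (\<Sum>w\<in>V. if w = c then x c else 0) - (\<Sum>w\<in>V. if w = d then x d else 0)"
      unfolding sum_subtractf[symmetric] by (intro sum.cong) (auto simp: algebra_simps)
    then show ?thesis using assms(1) that by simp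
  qed
  then show ?thesis
    unfolding edge_laplacian_pair using assms
    by (cases "v = a"; cases "v = b") (simp_all add: distrib_right sum.distrib)
qed

lemma sum_laplacian:
  fixes x :: "'v \<Rightarrow> 'a :: comm_ring_1"
  shows "(\<Sum>w\<in>V. laplacian G v w * x w)
       = (\<Sum>e\<in>edges G. \<Sum>w\<in>V. edge_laplacian (ends G e) v w * x w)"
  unfolding laplacian_def sum_distrib_right by (rule sum.swap)

lemma laplacian_column_sum:
  assumes "finite (verts G)" "pairs_edges G"
  shows "(\<Sum>v\<in>verts G. laplacian G v w) = (0 :: 'a :: comm_ring_1)"
proof -
  have "(\<Sum>v\<in>verts G. edge_laplacian (ends G e) v w) = (0 :: 'a)" if e: "e \<in> edges G" for e
  proof -
    obtain a b where ab: "a \<in> verts G" "b \<in> verts G" "ends G e = {a, b}"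
      using assms(2) e unfolding pairs_edges_def by blast
    have "(\<Sum>v\<in>verts G. edge_laplacian (ends G e) v w) = (\<Sum>v\<in>verts G. edge_laplacian {a, b} w v * (1 :: 'a))"
      unfolding ab(3) by (intro sum.cong refl trans[OF edge_laplacian_sym mult_1_right[symmetric]])
    also have "\<dots> = 0" unfolding sum_edge_laplacian[OF assms(1) ab(1,2)] by simp
    finally show ?thesis .
  qed
  then show ?thesis unfolding laplacian_def by (subst sum.swap) simp
qed

lemma pairs_edges_circulant_odd:
  assumes "n \<ge> 1"
  shows "pairs_edges (circulant_odd k s n)"
  unfolding pairs_edges_def
proof
  fix e assume e: "e \<in> edges (circulant_odd k s n)"
  show "\<exists>u\<in>verts (circulant_odd k s n). \<exists>v\<in>verts (circulant_odd k s n). ends (circulant_odd k s n) e = {u, v}"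
  proof (cases e)
    case (Inl p)
    obtain i j where p: "p = (i, j)" by (cases p)
    show ?thesis using e assms unfolding Inl p circulant_odd_def
      by (intro bexI[of _ i] bexI[of _ "(i + s j) mod (2 * n)"]) auto
  next
    case (Inr i)
    show ?thesis using e assms unfolding Inr circulant_odd_def
      by (intro bexI[of _ i] bexI[of _ "i + n"]) auto
  qed
qed

definition circulant_eigenvalue :: "nat \<Rightarrow> (nat \<Rightarrow> nat) \<Rightarrow> nat \<Rightarrow> complex \<Rightarrow> complex" where
  "circulant_eigenvalue k s n z = (\<Sum>j\<in>{1..k}. 2 - z ^ s j - inverse (z ^ s j)) + (1 - z ^ n)"

lemma power_mod_root_of_unity:
  fixes z :: "'a :: monoid_mult"
  assumes "z ^ N = 1"
  shows "z ^ (a mod N) = z ^ a"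
proof -
  have "z ^ a = z ^ (N * (a div N) + a mod N)" by simp
  also have "\<dots> = z ^ (a mod N)" unfolding power_add power_mult assms by simp
  finally show ?thesis ..
qed

lemma bij_betw_add_mod:
  fixes N t :: nat
  assumes "N > 0"
  shows "bij_betw (\<lambda>a. (a + t) mod N) {0..<N} {0..<N}"
proof (rule bij_betw_byWitness[where f' = "\<lambda>c. (c + (N - t mod N)) mod N"])
  have "N * (t div N) + t mod N = t" "t mod N < N" using assms by simp_all
  then have t: "t + (N - t mod N) = N * (t div N + 1)"
    unfolding distrib_left by linarith
  have inv: "(c + t + (N - t mod N)) mod N = c" "(c + (N - t mod N) + t) mod N = c" if "c < N" for c
  proof -
    have "c + t + (N - t mod N) = c + N * (t div N + 1)" by (simp only: add.assoc t)
    then show "(c + t + (N - t mod N)) mod N = c" using that by (simp only: mod_mult_self2 mod_less)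
    then show "(c + (N - t mod N) + t) mod N = c" by (simp only: ac_simps)
  qed
  show "\<forall>a\<in>{0..<N}. ((a + t) mod N + (N - t mod N)) mod N = a"
    "\<forall>c\<in>{0..<N}. ((c + (N - t mod N)) mod N + t) mod N = c"
    unfolding mod_add_left_eq using inv by simp_all
qed (use assms in auto)

text \<open>
  For one jump \<open>t\<close>, vertex \<open>i\<close> meets the edge starting at \<open>i\<close> and the edge ending at \<open>i\<close>. They are
  counted in two separate sums, which is correct also when the two edges coincide in a loop or have
  the same ends.
\<close>

lemma circulant_shift_eigenvalue:
  fixes z :: complex
  assumes z: "z ^ N = 1" and N: "N > 0" and i: "i < N"
  shows "(\<Sum>a = 0..<N. (if i = a then z ^ a - z ^ ((a + t) mod N) else 0)
            + (if i = (a + t) mod N then z ^ ((a + t) mod N) - z ^ a else 0))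
       = (2 - z ^ t - inverse (z ^ t)) * z ^ i"
proof -
  have z0: "z \<noteq> 0" using z N by (metis power_0_left zero_neq_one gr_implies_not0)
  let ?b = "\<lambda>a. (a + t) mod N"
  have A: "(\<Sum>a = 0..<N. if i = a then z ^ a - z ^ ?b a else 0) = z ^ i - z ^ i * z ^ t"
    using i by (simp add: sum.delta' power_mod_root_of_unity[OF z] power_add)
  have B: "(\<Sum>a = 0..<N. if i = ?b a then z ^ ?b a - z ^ a else 0) = z ^ i - z ^ i * inverse (z ^ t)"
  proof -
    have "(\<Sum>a = 0..<N. if i = ?b a then z ^ ?b a - z ^ a else 0)
        = (\<Sum>a = 0..<N. if i = ?b a then z ^ ?b a - z ^ ?b a * inverse (z ^ t) else 0)"
      using z0 by (intro sum.cong) (simp_all add: power_mod_root_of_unity[OF z] power_add)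
    also have "\<dots> = (\<Sum>c = 0..<N. if i = c then z ^ c - z ^ c * inverse (z ^ t) else 0)"
      by (rule sum.reindex_bij_betw[OF bij_betw_add_mod[OF N]])
    also have "\<dots> = z ^ i - z ^ i * inverse (z ^ t)" using i by (simp add: sum.delta')
    finally show ?thesis .
  qed
  show ?thesis unfolding sum.distrib A B by (simp add: algebra_simps)
qed

text \<open>
  The vector \<open>z ^ w\<close> is an eigenvector because all edges come in shift-invariant families. The antipodal
  edges have only \<open>n\<close> names, so exactly one of them meets \<open>i\<close>, starting at \<open>i\<close> or at \<open>i - n\<close>.
\<close>

lemma circulant_eigenvector:
  fixes z :: complex
  assumes n: "n \<ge> 1" and z: "z ^ (2 * n) = 1" and i: "i < 2 * n"
  shows "(\<Sum>w = 0..<2 * n. laplacian (circulant_odd k s n) i w * z ^ w) = circulant_eigenvalue k s n z * z ^ i"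
proof -
  let ?G = "circulant_odd k s n" and ?N = "2 * n"
  have V: "verts ?G = {0..<?N}" unfolding circulant_odd_def by simp
  have E: "edges ?G = ({0..<?N} \<times> {1..k}) <+> {0..<n}" unfolding circulant_odd_def by simp
  have eL: "ends ?G (Inl (a, j)) = {a, (a + s j) mod ?N}" and eR: "ends ?G (Inr a) = {a, a + n}" for a j
    unfolding circulant_odd_def by simp_all
  define g where "g a b = (if i = a then z ^ a - z ^ b else 0) + (if i = b then z ^ b - z ^ a else 0)" for a b
  have g: "(\<Sum>w\<in>{0..<?N}. edge_laplacian {a, b} i w * z ^ w) = g a b" if "a < ?N" "b < ?N" for a b
    unfolding g_def using that by (intro sum_edge_laplacian) auto
  have "(\<Sum>w = 0..<?N. laplacian ?G i w * z ^ w)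
      = (\<Sum>e\<in>edges ?G. \<Sum>w\<in>{0..<?N}. edge_laplacian (ends ?G e) i w * z ^ w)"
    by (rule sum_laplacian)
  also have "\<dots> = (\<Sum>p\<in>{0..<?N} \<times> {1..k}. \<Sum>w\<in>{0..<?N}. edge_laplacian (ends ?G (Inl p)) i w * z ^ w)
      + (\<Sum>a\<in>{0..<n}. \<Sum>w\<in>{0..<?N}. edge_laplacian (ends ?G (Inr a)) i w * z ^ w)"
    unfolding E by (subst sum.Plus) auto
  also have "(\<Sum>p\<in>{0..<?N} \<times> {1..k}. \<Sum>w\<in>{0..<?N}. edge_laplacian (ends ?G (Inl p)) i w * z ^ w)
      = (\<Sum>j\<in>{1..k}. \<Sum>a = 0..<?N. g a ((a + s j) mod ?N))"
    unfolding sum.cartesian_product' by (subst sum.swap) (auto intro!: sum.cong simp: eL g)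
  also have "\<dots> = (\<Sum>j\<in>{1..k}. (2 - z ^ s j - inverse (z ^ s j)) * z ^ i)"
    unfolding g_def using n by (intro sum.cong refl circulant_shift_eigenvalue[OF z _ i]) simp
  also have "(\<Sum>a\<in>{0..<n}. \<Sum>w\<in>{0..<?N}. edge_laplacian (ends ?G (Inr a)) i w * z ^ w)
      = (\<Sum>a = 0..<n. g a (a + n))"
    by (intro sum.cong refl) (simp add: eR g)
  also have "\<dots> = (1 - z ^ n) * z ^ i"
  proof -
    have zz: "z ^ n * z ^ n = 1" using z by (simp add: mult_2 power_add)
    define c where "c = (if i < n then i else i - n)"
    have "g a (a + n) = (if a = c then (1 - z ^ n) * z ^ i else 0)" if "a \<in> {0..<n}" for a
    proof (cases "i < n")
      case True
      then show ?thesis using that unfolding g_def c_def by (simp add: power_add algebra_simps)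
    next
      case False
      then have "z ^ i = z ^ (i - n) * z ^ n" by (simp flip: power_add)
      then have "(1 - z ^ n) * z ^ i = z ^ i - z ^ (i - n)" using zz by (simp add: algebra_simps)
      then show ?thesis using that False unfolding g_def c_def by auto
    qed
    then have "(\<Sum>a = 0..<n. g a (a + n)) = (\<Sum>a = 0..<n. if a = c then (1 - z ^ n) * z ^ i else 0)"
      by (rule sum.cong[OF refl])
    also have "\<dots> = (1 - z ^ n) * z ^ i" using i by (auto simp: c_def)
    finally show ?thesis .
  qed
  finally show ?thesis
    unfolding circulant_eigenvalue_def by (simp add: sum_distrib_right distrib_right)
qed

theorem tau_eigenvalue_prod:
  assumes n: "n \<ge> 1"
  shows "of_nat (2 * n) * of_nat (tau k s n)
       = (\<Prod>z\<in>{z. z ^ (2 * n) = 1} - {1}. circulant_eigenvalue k s n z)"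
proof -
  let ?G = "circulant_odd k s n"
  define m where "m = 2 * n - 1"
  have m: "Suc m = 2 * n" using n by (simp add: m_def)
  have V: "verts ?G = {0..<Suc m}" unfolding m circulant_odd_def by simp
  have fin: "finite (edges ?G)" unfolding circulant_odd_def by simp
  have "of_nat (Suc m) * det (mat m m (\<lambda>(i, j). laplacian ?G i j))
      = (\<Prod>z\<in>{z. z ^ Suc m = 1} - {1}. circulant_eigenvalue k s n z)"
  proof (rule reduced_det_eq_eigenvalue_prod)
    fix j
    show "(\<Sum>i = 0..<Suc m. laplacian ?G i j) = (0 :: complex)"
      using laplacian_column_sum[of ?G j] pairs_edges_circulant_odd[OF n] unfolding V by simp
  next
    show "circulant_eigenvalue k s n 1 = 0" unfolding circulant_eigenvalue_def by simp
  next
    fix z :: complex and i assume "z ^ Suc m = 1" "i < Suc m"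
    then show "(\<Sum>j = 0..<Suc m. laplacian ?G i j * z ^ j) = circulant_eigenvalue k s n z * z ^ i"
      unfolding m using circulant_eigenvector[OF n] by blast
  qed
  moreover have "det (mat m m (\<lambda>(i, j). laplacian ?G i j)) = (of_nat (tau k s n) :: complex)"
    unfolding tau_def by (rule matrix_tree[OF pairs_edges_circulant_odd[OF n] V fin])
  ultimately show ?thesis unfolding m by simp
qed

section \<open>Products over roots of unity\<close>

definition geom_poly :: "nat \<Rightarrow> 'a :: comm_ring_1 poly" where
  "geom_poly n = (\<Sum>i<n. monom 1 i)"

lemma poly_geom_poly: "poly (geom_poly n) x = (\<Sum>i<n. x ^ i)"
  by (simp add: geom_poly_def poly_sum poly_monom)

lemma coeff_geom_poly: "coeff (geom_poly n) i = (if i < n then 1 else 0)"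
  by (simp add: geom_poly_def coeff_sum sum.delta)

lemma degree_geom_poly:
  assumes "n > 0"
  shows "degree (geom_poly n :: 'a :: comm_ring_1 poly) = n - 1"
proof (rule antisym)
  show "degree (geom_poly n :: 'a poly) \<le> n - 1"
    by (rule degree_le) (use assms in \<open>auto simp: coeff_geom_poly\<close>)
  show "n - 1 \<le> degree (geom_poly n :: 'a poly)"
    by (rule le_degree) (use assms in \<open>simp add: coeff_geom_poly\<close>)
qed

lemma linear_times_geom_poly: "[:- 1, 1:] * geom_poly n = monom 1 n - (1 :: 'a :: comm_ring_1 poly)"
proof (induction n)
  case 0
  then show ?case by (simp add: geom_poly_def one_pCons monom_0)
next
  case (Suc n)
  have "[:- 1, 1:] * geom_poly (Suc n) = [:- 1, 1:] * geom_poly n + [:- 1, 1:] * (monom 1 n :: 'a poly)"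
    by (simp add: geom_poly_def distrib_left)
  also have "[:- 1, 1:] * (monom 1 n :: 'a poly) = monom 1 (Suc n) - monom 1 n"
    by (simp add: monom_Suc)
  finally show ?case using Suc.IH by simp
qed

lemma finite_power_eq:
  assumes "n > 0"
  shows "finite {z :: complex. z ^ n = c}"
proof -
  have "{z :: complex. z ^ n = c} = {z. poly (monom 1 n - [:c:]) z = 0}"
    by (simp add: poly_monom)
  moreover have "monom 1 n - [:c:] \<noteq> 0"
  proof
    assume "monom 1 n - [:c:] = 0"
    then have "coeff (monom 1 n - [:c:]) n = 0" by simp
    then show False using assms by (simp add: coeff_pCons split: nat.splits)
  qed
  ultimately show ?thesis using poly_roots_finite by metis
qed

lemma prod_linear_roots_power_eq:
  fixes c :: complex
  assumes "n > 0" "c \<noteq> 0"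
  shows "(\<Prod>z | z ^ n = c. [:- z, 1:]) = monom 1 n - [:c:]"
proof -
  let ?p = "monom 1 n - [:c:]"
  have root: "poly ?p z = 0 \<longleftrightarrow> z ^ n = c" for z by (simp add: poly_monom)
  have "rsquarefree ?p"
    unfolding rsquarefree_roots
  proof (intro allI notI)
    fix z assume z: "poly ?p z = 0 \<and> poly (pderiv ?p) z = 0"
    have "pderiv ?p = monom (of_nat n) (n - 1)" by (simp add: pderiv_diff pderiv_monom pderiv_pCons)
    then have "of_nat n * z ^ (n - 1) = 0" using z by (simp add: poly_monom)
    then have "z = 0" using assms(1) by simp
    then show False using z assms root[of z] by (auto simp: power_0_left)
  qed
  from complex_poly_decompose_rsquarefree[OF this]
  have "Polynomial.smult (lead_coeff ?p) (\<Prod>z | z ^ n = c. [:- z, 1:]) = ?p" unfolding root .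
  moreover have "lead_coeff ?p = 1"
  proof -
    have "degree ?p = n"
      using assms(1) degree_add_eq_left[of "- [:c:]" "monom 1 n"]
      by (simp add: degree_monom_eq del: minus_pCons)
    then show ?thesis using assms(1) by (simp add: coeff_pCons split: nat.splits)
  qed
  ultimately show ?thesis by (simp only: smult_1_left)
qed

text \<open>
  The factor belonging to \<open>z = 1\<close> is cancelled as a polynomial, so that the formula also covers
  \<open>x = 1\<close>, where it gives the value \<open>n\<close>.
\<close>

lemma prod_diff_nontrivial_roots_of_unity:
  fixes x :: complex
  assumes "n > 0"
  shows "(\<Prod>z\<in>{z. z ^ n = 1} - {1}. x - z) = (\<Sum>i<n. x ^ i)"
proof -
  have "[:- 1, 1:] * (\<Prod>z\<in>{z. z ^ n = 1} - {1}. [:- z, 1:]) = (\<Prod>z | z ^ n = 1. [:- z, 1 :: complex:])"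
    using finite_power_eq[OF assms, of 1] by (subst prod.remove[of _ 1]) auto
  also have "\<dots> = [:- 1, 1:] * geom_poly n"
    unfolding linear_times_geom_poly using prod_linear_roots_power_eq[OF assms, of 1]
    by (simp add: one_pCons)
  finally have "(\<Prod>z\<in>{z. z ^ n = 1} - {1}. [:- z, 1:]) = (geom_poly n :: complex poly)"
    by (subst (asm) mult_left_cancel) auto
  then have "poly (\<Prod>z\<in>{z. z ^ n = 1} - {1}. [:- z, 1:]) x = poly (geom_poly n) x" by simp
  then show ?thesis by (simp add: poly_prod poly_geom_poly)
qed

lemma prod_diff_roots_of_minus_one:
  fixes x :: complex
  assumes "n > 0"
  shows "(\<Prod>z | z ^ n = - 1. x - z) = x ^ n + 1"
proof -
  have "poly (\<Prod>z | z ^ n = - 1. [:- z, 1:]) x = poly (monom 1 n - [:- 1:]) x"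
    by (subst prod_linear_roots_power_eq[OF assms]) auto
  then show ?thesis by (simp add: poly_prod poly_monom)
qed

text \<open>
  The resultant-type symmetry between \<open>S\<close> and the roots of \<open>p\<close>; an even degree makes the signs
  disappear.
\<close>

lemma prod_poly_over_set:
  fixes r :: "nat \<Rightarrow> 'a :: idom"
  assumes "even d" "p = (\<Prod>i<d. [:- r i, 1:])"
  shows "(\<Prod>z\<in>S. poly p z) = (\<Prod>i<d. \<Prod>z\<in>S. r i - z)"
proof -
  have "(\<Prod>z\<in>S. poly p z) = (\<Prod>i<d. \<Prod>z\<in>S. z - r i)"
    unfolding assms(2) poly_prod by (subst prod.swap) simp
  also have "\<dots> = (\<Prod>i<d. (- 1) ^ card S * (\<Prod>z\<in>S. r i - z))"
  proof (rule prod.cong[OF refl])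
    fix i
    have "(\<Prod>z\<in>S. z - r i) = (\<Prod>z\<in>S. - 1 * (r i - z))" by simp
    then show "(\<Prod>z\<in>S. z - r i) = (- 1) ^ card S * (\<Prod>z\<in>S. r i - z)"
      by (simp only: prod.distrib prod_constant)
  qed
  also have "\<dots> = (\<Prod>i<d. \<Prod>z\<in>S. r i - z)"
    unfolding prod.distrib prod_constant using assms(1) by (simp flip: power_mult)
  finally show ?thesis .
qed

lemma monic_even_poly_roots:
  fixes p :: "complex poly"
  assumes "even (degree p)" "lead_coeff p = 1" "coeff p 0 = 1"
  obtains r where "p = (\<Prod>i<degree p. [:- r i, 1:])" "(\<Prod>i<degree p. r i) = 1"
proof -
  obtain r where r: "Polynomial.smult (lead_coeff p) (\<Prod>i<degree p. [:- r i, 1:]) = p"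
    by (rule complex_poly_decompose')
  then have p: "p = (\<Prod>i<degree p. [:- r i, 1:])" unfolding assms(2) by simp
  have "poly p 0 = (\<Prod>i<degree p. - 1 * r i)" by (subst p) (simp add: poly_prod)
  also have "\<dots> = (\<Prod>i<degree p. r i)"
    unfolding prod.distrib prod_constant using assms(1) by simp
  finally show ?thesis using that[OF p] assms(3) by (simp add: poly_0_coeff_0)
qed

section \<open>A closed form for the number of spanning trees\<close>

text \<open>
  Since \<open>2 - z ^ t - inverse (z ^ t) = - (z ^ t - 1)\<^sup>2 / z ^ t\<close>, the Laurent polynomial giving the eigenvalues for
  \<open>z ^ n = 1\<close> has a double zero at 1. This polynomial is what remains of its numerator, up to sign, after the
  factor \<open>(z - 1)\<^sup>2\<close> is taken out. The largest jump alone determines its constant and leading coefficients.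
\<close>

definition jump_poly :: "nat \<Rightarrow> (nat \<Rightarrow> nat) \<Rightarrow> complex poly" where
  "jump_poly k s = (\<Sum>j\<in>{1..k}. monom 1 (s k - s j) * geom_poly (s j) ^ 2)"

context
  fixes k :: nat and s :: "nat \<Rightarrow> nat"
  assumes k: "k \<ge> 1" and s1: "s 1 \<ge> 1" and mono: "strict_mono_on {1..k} s"
begin

lemma s_pos: "j \<in> {1..k} \<Longrightarrow> s j \<ge> 1"
  using strict_mono_onD[OF mono, of 1 j] s1 k by (cases "j = 1") auto

lemma s_less: "j \<in> {1..k} \<Longrightarrow> j \<noteq> k \<Longrightarrow> s j < s k"
  using strict_mono_onD[OF mono, of j k] by auto

lemma s_le: "j \<in> {1..k} \<Longrightarrow> s j \<le> s k"
  using s_less[of j] by (cases "j = k") auto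

lemma coeff_jump_poly_0: "coeff (jump_poly k s) 0 = 1"
proof -
  have "coeff (monom 1 (s k - s j) * geom_poly (s j) ^ 2 :: complex poly) 0 = (if j = k then 1 else 0)"
    if "j \<in> {1..k}" for j
  proof (cases "j = k")
    case True
    then show ?thesis using s_pos[OF that]
      by (simp add: monom_0 power2_eq_square coeff_mult coeff_geom_poly)
  next
    case False
    then show ?thesis using s_less[OF that] by (simp add: coeff_mult)
  qed
  then have "coeff (jump_poly k s) 0 = (\<Sum>j\<in>{1..k}. if j = k then 1 else 0)"
    unfolding jump_poly_def coeff_sum by (rule sum.cong[OF refl])
  then show ?thesis using k by simp
qed

lemma degree_jump_term:
  assumes "j \<in> {1..k}"
  shows "degree (monom 1 (s k - s j) * geom_poly (s j) ^ 2 :: complex poly) = s k + s j - 2"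
proof -
  have g: "degree (geom_poly (s j) :: complex poly) = s j - 1"
    using s_pos[OF assms] by (intro degree_geom_poly) simp
  have "geom_poly (s j) \<noteq> (0 :: complex poly)"
  proof
    assume "geom_poly (s j) = (0 :: complex poly)"
    then have "coeff (geom_poly (s j) :: complex poly) 0 = 0" by simp
    then show False using s_pos[OF assms] by (simp add: coeff_geom_poly)
  qed
  then show ?thesis using s_pos[OF assms] s_le[OF assms]
    by (simp add: degree_mult_eq degree_power_eq degree_monom_eq g)
qed

lemma coeff_jump_poly_top: "coeff (jump_poly k s) (2 * s k - 2) = 1"
proof -
  have "coeff (monom 1 (s k - s j) * geom_poly (s j) ^ 2 :: complex poly) (2 * s k - 2) = (if j = k then 1 else 0)"
    if j: "j \<in> {1..k}" for j
  proof (cases "j = k")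
    case True
    have g: "degree (geom_poly (s k) :: complex poly) = s k - 1"
      using s_pos[OF j] True by (intro degree_geom_poly) simp
    have e: "2 * s k - 2 = (s k - 1) + (s k - 1)" by simp
    have "coeff (geom_poly (s k) * geom_poly (s k) :: complex poly) (2 * s k - 2) = 1"
      unfolding e using coeff_mult_degree_sum[of "geom_poly (s k) :: complex poly" "geom_poly (s k)"]
      using s_pos[OF j] True unfolding g by (simp add: coeff_geom_poly)
    then show ?thesis using True by (simp add: power2_eq_square monom_0)
  next
    case False
    then show ?thesis using s_less[OF j] s_pos[OF j] degree_jump_term[OF j]
      by (subst coeff_eq_0) auto
  qed
  then have "coeff (jump_poly k s) (2 * s k - 2) = (\<Sum>j\<in>{1..k}. if j = k then 1 else 0)"
    unfolding jump_poly_def coeff_sum by (rule sum.cong[OF refl])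
  then show ?thesis using k by simp
qed

lemma degree_jump_poly: "degree (jump_poly k s) = 2 * s k - 2"
proof (rule antisym)
  show "degree (jump_poly k s) \<le> 2 * s k - 2"
    unfolding jump_poly_def
  proof (rule degree_sum_le)
    fix j assume "j \<in> {1..k}"
    then show "degree (monom 1 (s k - s j) * geom_poly (s j) ^ 2 :: complex poly) \<le> 2 * s k - 2"
      using degree_jump_term[of j] s_le[of j] by simp
  qed simp
  show "2 * s k - 2 \<le> degree (jump_poly k s)" by (rule le_degree) (simp add: coeff_jump_poly_top)
qed

text \<open>
  The value is the sum of the squares of the jumps; that it is nonzero means that the zero of the
  eigenvalue at \<open>z = 1\<close> is exactly double.
\<close>

lemma poly_jump_poly_1: "poly (jump_poly k s) 1 \<noteq> 0"
proof -
  have R1: "poly (jump_poly k s) 1 = of_nat (\<Sum>j\<in>{1..k}. s j ^ 2)"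
    unfolding jump_poly_def by (simp add: poly_sum poly_monom poly_geom_poly)
  have "s k ^ 2 \<le> (\<Sum>j\<in>{1..k}. s j ^ 2)" using k by (intro member_le_sum) auto
  moreover have "0 < s k ^ 2" using s_pos[of k] k by simp
  ultimately have "(\<Sum>j\<in>{1..k}. s j ^ 2) \<noteq> 0" by linarith
  then show ?thesis unfolding R1 of_nat_eq_0_iff .
qed

lemma sum_jumps_eq:
  fixes z :: complex
  assumes z: "z \<noteq> 0"
  shows "(\<Sum>j\<in>{1..k}. 2 - z ^ s j - inverse (z ^ s j))
       = - ((z - 1) ^ 2 * poly (jump_poly k s) z) / z ^ s k"
proof -
  have "2 - z ^ s j - inverse (z ^ s j)
      = - ((z - 1) ^ 2 * (z ^ (s k - s j) * (\<Sum>i<s j. z ^ i) ^ 2)) / z ^ s k" if "j \<in> {1..k}" for j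
  proof -
    have e: "z ^ s k = z ^ (s k - s j) * z ^ s j" using s_le[OF that] by (simp flip: power_add)
    have "(z - 1) * (\<Sum>i<s j. z ^ i) = z ^ s j - 1" by (simp add: power_diff_1_eq)
    then have "(z - 1) ^ 2 * (\<Sum>i<s j. z ^ i) ^ 2 = (z ^ s j - 1) ^ 2"
      by (simp flip: power_mult_distrib)
    then have "- ((z - 1) ^ 2 * (z ^ (s k - s j) * (\<Sum>i<s j. z ^ i) ^ 2))
        = - (z ^ (s k - s j) * (z ^ s j - 1) ^ 2)" by (simp add: ac_simps)
    moreover have "2 - w - inverse w = - (c * (w - 1) ^ 2) / (c * w)" if "c \<noteq> 0" "w \<noteq> 0" for c w :: complex
      using that by (simp add: field_simps power2_eq_square)
    ultimately show ?thesis unfolding e using z by simp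
  qed
  then have "(\<Sum>j\<in>{1..k}. 2 - z ^ s j - inverse (z ^ s j))
      = (\<Sum>j\<in>{1..k}. - ((z - 1) ^ 2 * (z ^ (s k - s j) * (\<Sum>i<s j. z ^ i) ^ 2)) / z ^ s k)"
    by (rule sum.cong[OF refl])
  also have "\<dots> = - ((z - 1) ^ 2 * poly (jump_poly k s) z) / z ^ s k"
    unfolding jump_poly_def
    by (simp add: poly_sum poly_monom poly_geom_poly sum_distrib_left sum_negf flip: sum_divide_distrib)
  finally show ?thesis .
qed

text \<open>
  For \<open>z ^ n = - 1\<close> the antipodal edges add 2 to the eigenvalue; this is the numerator in that case,
  up to sign. Its name comes from the eigenvectors, which change sign under a shift by \<open>n\<close>.
\<close>

definition antiperiodic_poly :: "complex poly" where
  "antiperiodic_poly = [:- 1, 1:] ^ 2 * jump_poly k s - monom 2 (s k)"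

lemma antiperiodic_poly: "degree antiperiodic_poly = 2 * s k" "lead_coeff antiperiodic_poly = 1" "coeff antiperiodic_poly 0 = 1"
proof -
  have sk: "s k \<ge> 1" using s_pos[of k] k by simp
  let ?p = "[:- 1, 1:] ^ 2 * jump_poly k s"
  have R0: "jump_poly k s \<noteq> 0" using coeff_jump_poly_0 by auto
  have lin: "degree ([:- 1, 1:] ^ 2 :: complex poly) = 2" by (simp add: degree_power_eq)
  have dp: "degree ?p = 2 * s k"
    using R0 sk by (subst degree_mult_eq) (simp_all add: lin degree_jump_poly)
  have lp: "lead_coeff ?p = 1"
    by (simp add: lead_coeff_mult lead_coeff_power degree_jump_poly coeff_jump_poly_top)
  have small: "degree (- monom 2 (s k) :: complex poly) < degree ?p"
    unfolding dp using sk by (simp add: degree_monom_eq)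
  have e: "antiperiodic_poly = ?p + - monom 2 (s k)" unfolding antiperiodic_poly_def by simp
  show "degree antiperiodic_poly = 2 * s k" unfolding e using degree_add_eq_left[OF small] dp by simp
  then show "lead_coeff antiperiodic_poly = 1"
    unfolding e using lp sk dp by (simp add: coeff_monom)
  show "coeff antiperiodic_poly 0 = 1" using sk
    unfolding antiperiodic_poly_def poly_0_coeff_0[symmetric]
    by (simp add: poly_monom) (simp add: poly_0_coeff_0 coeff_jump_poly_0)
qed

text \<open>
  The roots of unity of order \<open>2 * n\<close> are split by the sign of \<open>z ^ n\<close>. On each half the product of
  the eigenvalues is turned into a product over the roots \<open>a\<close> of the first and \<open>b\<close> of the second
  polynomial above, with factors \<open>a ^ n - 1\<close> (divided by \<open>a - 1\<close>) and \<open>b ^ n + 1\<close>. The denominators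
  \<open>z ^ s k\<close> contribute a sign that does not depend on \<open>n\<close>. The two conditions on the products of \<open>u\<close> and
  of \<open>\<epsilon>\<close>, which come from the constant coefficients and even degrees of these polynomials, carry the
  symmetry of the generating function.
\<close>

theorem tau_closed_form:
  obtains C :: complex and u \<epsilon> :: "nat + nat \<Rightarrow> complex" and I :: "(nat + nat) set"
  where "finite I" "(\<Prod>i\<in>I. u i) = 1" "(\<Prod>i\<in>I. \<epsilon> i) = 1" "\<And>i. \<epsilon> i = 1 \<or> \<epsilon> i = - 1"
    "\<And>n. n \<ge> 1 \<Longrightarrow> of_nat (tau k s n) = C * of_nat n * (\<Prod>i\<in>I. u i ^ n + \<epsilon> i)"
proof -
  have sk: "s k \<ge> 1" using s_pos[of k] k by simp
  let ?R = "jump_poly k s" and ?d = "2 * s k - 2" and ?e = "2 * s k"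
  have "even (degree ?R)" "lead_coeff ?R = 1"
    using coeff_jump_poly_top by (simp_all add: degree_jump_poly)
  then obtain a where a': "?R = (\<Prod>i<degree ?R. [:- a i, 1:])" "(\<Prod>i<degree ?R. a i) = 1"
    by (rule monic_even_poly_roots[OF _ _ coeff_jump_poly_0])
  note a = a'[unfolded degree_jump_poly]
  have "even (degree antiperiodic_poly)" using antiperiodic_poly(1) by simp
  then obtain b where b': "antiperiodic_poly = (\<Prod>i<degree antiperiodic_poly. [:- b i, 1:])" "(\<Prod>i<degree antiperiodic_poly. b i) = 1"
    by (rule monic_even_poly_roots[OF _ antiperiodic_poly(2,3)])
  note b = b'[unfolded antiperiodic_poly(1)]
  define C where "C = (- 1) ^ (s k + 1) / (2 * poly ?R 1)"
  have R1: "poly ?R 1 = (\<Prod>i<?d. a i - 1)"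
    using prod_poly_over_set[OF _ a(1), of "{1}"] by simp
  have a1: "a i \<noteq> 1" if "i < ?d" for i
    using poly_jump_poly_1 that unfolding R1 by auto
  define I :: "(nat + nat) set" where "I = {..<?d} <+> {..<?e}"
  define u where "u = case_sum a b"
  define \<epsilon> :: "nat + nat \<Rightarrow> complex" where "\<epsilon> = case_sum (\<lambda>_. - 1) (\<lambda>_. 1)"
  have "of_nat (tau k s n) = C * of_nat n * (\<Prod>i\<in>I. u i ^ n + \<epsilon> i)" if n: "n \<ge> 1" for n
  proof -
    let ?S1 = "{z :: complex. z ^ n = 1} - {1}" and ?S2 = "{z :: complex. z ^ n = - 1}"
    let ?S = "{z :: complex. z ^ (2 * n) = 1} - {1}"
    have fin: "finite ?S1" "finite ?S2" using n finite_power_eq[of n] by auto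
    have "z ^ (2 * n) = 1 \<longleftrightarrow> z ^ n = 1 \<or> z ^ n = - 1" for z :: complex
      by (simp only: mult.commute[of 2] power_mult power2_eq_1_iff)
    then have S: "?S = ?S1 \<union> ?S2" by auto
    have disj: "?S1 \<inter> ?S2 = {}" by auto
    have z0: "z \<noteq> 0" if "z \<in> ?S" for z using that n by (auto simp: power_0_left)
    define \<mu> where "\<mu> z = - (z ^ s k) * circulant_eigenvalue k s n z" for z
    have \<mu>1: "\<mu> z = (z - 1) ^ 2 * poly ?R z" if "z \<in> ?S1" for z
      using that z0[of z] sum_jumps_eq[of z] unfolding S \<mu>_def circulant_eigenvalue_def by simp
    have \<mu>2: "\<mu> z = poly antiperiodic_poly z" if "z \<in> ?S2" for z
    proof -
      have "z \<noteq> 0" using that z0 S by blast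
      then show ?thesis
        using that sum_jumps_eq[of z] unfolding \<mu>_def circulant_eigenvalue_def antiperiodic_poly_def
        by (simp add: poly_monom algebra_simps)
    qed
    have "(\<Prod>z\<in>?S1. (z - 1) ^ 2) = (\<Prod>z\<in>?S1. (1 - z) ^ 2)"
      by (intro prod.cong refl power2_commute)
    also have "\<dots> = (\<Prod>z\<in>?S1. (1 - z)) ^ 2" by (rule prod_power_distrib[symmetric])
    also have "(\<Prod>z\<in>?S1. (1 - z)) = of_nat n"
      using prod_diff_nontrivial_roots_of_unity[of n 1] n by simp
    finally have sq: "(\<Prod>z\<in>?S1. (z - 1) ^ 2) = of_nat n ^ 2" .
    have "(\<Prod>z\<in>?S1. poly ?R z) = (\<Prod>i<?d. \<Prod>z\<in>?S1. a i - z)"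
      using prod_poly_over_set[OF _ a(1)] by simp
    also have "\<dots> = (\<Prod>i<?d. (a i ^ n - 1) / (a i - 1))"
    proof (rule prod.cong[OF refl])
      fix i assume "i \<in> {..<?d}"
      then have "a i \<noteq> 1" using a1 by simp
      then show "(\<Prod>z\<in>?S1. a i - z) = (a i ^ n - 1) / (a i - 1)"
        using prod_diff_nontrivial_roots_of_unity[of n "a i"] n
        by (simp add: geometric_sum)
    qed
    also have "\<dots> = (\<Prod>i<?d. a i ^ n - 1) / poly ?R 1" unfolding R1 by (rule prod_dividef)
    finally have R: "(\<Prod>z\<in>?S1. poly ?R z) = (\<Prod>i<?d. a i ^ n - 1) / poly ?R 1" .
    have Q: "(\<Prod>z\<in>?S2. poly antiperiodic_poly z) = (\<Prod>i<?e. b i ^ n + 1)"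
      using prod_poly_over_set[OF _ b(1), of ?S2] prod_diff_roots_of_minus_one[of n] n by simp
    \<comment> \<open>All roots of unity in \<open>?S\<close> multiply to -1, and there is an odd number of them.\<close>
    have "(\<Prod>z\<in>?S. 0 - z) = 1"
      using prod_diff_nontrivial_roots_of_unity[of "2 * n" 0] n by (simp add: power_0_left)
    then have pz: "(\<Prod>z\<in>?S. - z) = 1" by simp
    have card: "odd (card ?S)"
    proof -
      have "card ?S = 2 * n - 1" using card_roots_unity_eq[of "2 * n"] n
        by (subst card_Diff_singleton) auto
      then show ?thesis using n by simp
    qed
    have "(\<Prod>z\<in>?S. z) = (\<Prod>z\<in>?S. - 1 * - z)" by simp
    also have "\<dots> = - 1" unfolding prod.distrib prod_constant pz using card by simp
    finally have pz': "(\<Prod>z\<in>?S. z) = - 1" .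
    have "(\<Prod>z\<in>?S. - (z ^ s k)) = (\<Prod>z\<in>?S. - 1 * z ^ s k)" by simp
    also have "\<dots> = (- 1) ^ (s k + 1)"
      unfolding prod.distrib prod_constant prod_power_distrib[symmetric] pz' using card by simp
    finally have sgn: "(\<Prod>z\<in>?S. - (z ^ s k)) = (- 1) ^ (s k + 1)" .
    have "(\<Prod>z\<in>?S. \<mu> z) = (\<Prod>z\<in>?S1. (z - 1) ^ 2 * poly ?R z) * (\<Prod>z\<in>?S2. poly antiperiodic_poly z)"
      unfolding S prod.union_disjoint[OF fin disj] using \<mu>1 \<mu>2 by simp
    also have "\<dots> = of_nat n ^ 2 * ((\<Prod>i<?d. a i ^ n - 1) / poly ?R 1) * (\<Prod>i<?e. b i ^ n + 1)"
      unfolding prod.distrib sq R Q ..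
    finally have P: "(\<Prod>z\<in>?S. \<mu> z) = of_nat n ^ 2 * ((\<Prod>i<?d. a i ^ n - 1) / poly ?R 1) * (\<Prod>i<?e. b i ^ n + 1)" .
    have "(\<Prod>z\<in>?S. \<mu> z) = (- 1) ^ (s k + 1) * (of_nat (2 * n) * of_nat (tau k s n))"
      unfolding \<mu>_def prod.distrib sgn tau_eigenvalue_prod[OF n] ..
    then have eq: "(- 1) ^ (s k + 1) * (\<Prod>z\<in>?S. \<mu> z) = of_nat (2 * n) * of_nat (tau k s n)"
      by (simp flip: power_add mult.assoc)
    have "of_nat (tau k s n) = (- 1) ^ (s k + 1) * (\<Prod>z\<in>?S. \<mu> z) / of_nat (2 * n)"
      unfolding eq using n by simp
    also have "\<dots> = C * of_nat n * ((\<Prod>i<?d. a i ^ n - 1) * (\<Prod>i<?e. b i ^ n + 1))"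
      unfolding P C_def using n poly_jump_poly_1 by (simp add: power2_eq_square ac_simps)
    also have "(\<Prod>i<?d. a i ^ n - 1) * (\<Prod>i<?e. b i ^ n + 1) = (\<Prod>i\<in>I. u i ^ n + \<epsilon> i)"
      unfolding I_def by (subst prod.Plus) (simp_all add: u_def \<epsilon>_def)
    finally show ?thesis .
  qed
  moreover have "\<epsilon> i = 1 \<or> \<epsilon> i = - 1" for i unfolding \<epsilon>_def by (cases i) auto
  moreover have "finite I" "(\<Prod>i\<in>I. u i) = 1" "(\<Prod>i\<in>I. \<epsilon> i) = 1"
    unfolding I_def using a(2) b(2) by (simp_all add: prod.Plus u_def \<epsilon>_def)
  ultimately show ?thesis using that by blast
qed

end

section \<open>Descent of rational series from complex to integer coefficients\<close>

text \<open>
  Coordinate at 1 with respect to a basis of \<open>\<complex>\<close> over \<open>\<rat>\<close> that contains 1.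
\<close>

lemma rational_linear_functional_exists:
  obtains \<phi> :: "complex \<Rightarrow> rat"
  where "\<And>x y. \<phi> (x + y) = \<phi> x + \<phi> y" "\<And>q x. \<phi> (of_rat q * x) = q * \<phi> x" "\<phi> 1 = 1"
proof -
  interpret Q: vector_space "\<lambda>(q :: rat) (z :: complex). of_rat q * z"
    by unfold_locales (simp_all add: of_rat_add of_rat_mult algebra_simps)
  have ind: "Q.independent {1}" by simp
  define B where "B = Q.extend_basis {1}"
  have B: "Q.independent B" "Q.span B = UNIV" "1 \<in> B"
    unfolding B_def using Q.independent_extend_basis[OF ind] Q.span_extend_basis[OF ind]
      Q.extend_basis_superset[OF ind] by auto
  let ?\<phi> = "\<lambda>z. Q.representation B z 1"
  show thesis
  proof (rule that[of ?\<phi>])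
    show "?\<phi> (x + y) = ?\<phi> x + ?\<phi> y" for x y
      using Q.representation_add[OF B(1), of y x] B(2) by simp
    show "?\<phi> (of_rat q * x) = q * ?\<phi> x" for q x
      using Q.representation_scale[OF B(1), of x q] B(2) by simp
    show "?\<phi> 1 = 1" using Q.representation_basis[OF B(1,3)] by simp
  qed
qed

text \<open>
  A \<open>\<rat>\<close>-linear functional applied to the coefficients passes through the product with a series whose
  coefficients are rational, and it keeps the constant coefficient 1 of the denominator.
\<close>

lemma rational_series_descent:
  fixes t :: "nat \<Rightarrow> rat" and P Q :: "complex poly"
  assumes eq: "Abs_fps (\<lambda>n. of_rat (t n)) * fps_of_poly Q = fps_of_poly P" and Q0: "coeff Q 0 = 1"
  obtains P' Q' :: "rat poly"
  where "Abs_fps t * fps_of_poly Q' = fps_of_poly P'" "coeff Q' 0 = 1"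
proof -
  obtain \<phi> :: "complex \<Rightarrow> rat"
    where add: "\<And>x y. \<phi> (x + y) = \<phi> x + \<phi> y" and scale: "\<And>q x. \<phi> (of_rat q * x) = q * \<phi> x" and one: "\<phi> 1 = 1"
    by (rule rational_linear_functional_exists) (rule that)
  have zero: "\<phi> 0 = 0" using scale[of 0 0] by simp
  have sum: "\<phi> (\<Sum>i\<in>A. f i) = (\<Sum>i\<in>A. \<phi> (f i))" for f :: "nat \<Rightarrow> complex" and A
    by (induction A rule: infinite_finite_induct) (simp_all add: zero add)
  have "Abs_fps t * fps_of_poly (map_poly \<phi> Q) = fps_of_poly (map_poly \<phi> P)"
  proof (rule fps_ext)
    fix n
    have "(\<Sum>i = 0..n. of_rat (t i) * coeff Q (n - i)) = coeff P n"
      using arg_cong[OF eq, of "\<lambda>F. fps_nth F n"] by (simp add: fps_mult_nth)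
    then have "(\<Sum>i = 0..n. t i * \<phi> (coeff Q (n - i))) = \<phi> (coeff P n)"
      by (simp add: sum scale flip: \<open>_ = coeff P n\<close>)
    then show "fps_nth (Abs_fps t * fps_of_poly (map_poly \<phi> Q)) n = fps_nth (fps_of_poly (map_poly \<phi> P)) n"
      by (simp add: fps_mult_nth coeff_map_poly zero)
  qed
  then show thesis by (rule that) (simp add: coeff_map_poly zero Q0 one)
qed

lemma rat_poly_common_denominator:
  fixes p :: "rat poly"
  shows "\<exists>d :: int. d \<noteq> 0 \<and> (\<exists>p'. map_poly of_int p' = Polynomial.smult (of_int d) p)"
proof (induction p)
  case 0
  show ?case by (intro exI[of _ 1] conjI exI[of _ 0]) simp_all
next
  case (pCons a p)
  then obtain d p' where d: "d \<noteq> 0" "map_poly of_int p' = Polynomial.smult (of_int d) p" by blast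
  obtain x y where "quotient_of a = (x, y)" by (cases "quotient_of a")
  then have xy: "a = of_int x / of_int y" "y \<noteq> 0"
    using quotient_of_div quotient_of_denom_pos by blast+
  have "map_poly of_int (pCons (d * x) (Polynomial.smult y p')) = Polynomial.smult (of_int (d * y)) (pCons a p)"
    using d xy by (simp add: map_poly_pCons hom_distribs mult.commute)
  then show ?case using d(1) xy(2) by (metis mult_eq_0_iff)
qed

lemma int_polys_of_rat_polys:
  fixes t :: "nat \<Rightarrow> rat" and P Q :: "rat poly"
  assumes eq: "Abs_fps t * fps_of_poly Q = fps_of_poly P" and Q0: "coeff Q 0 = 1"
  obtains P' Q' :: "int poly"
  where "Abs_fps t * fps_of_poly (map_poly of_int Q') = fps_of_poly (map_poly of_int P')" "coeff Q' 0 \<noteq> 0"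
proof -
  obtain d p where d: "d \<noteq> 0" "map_poly of_int p = Polynomial.smult (of_int d) P"
    using rat_poly_common_denominator by blast
  obtain e q where e: "e \<noteq> 0" "map_poly of_int q = Polynomial.smult (of_int e) Q"
    using rat_poly_common_denominator by blast
  show thesis
  proof (rule that)
    show "Abs_fps t * fps_of_poly (map_poly of_int (Polynomial.smult d q))
        = fps_of_poly (map_poly of_int (Polynomial.smult e p))"
      using eq by (simp add: hom_distribs d e fps_of_poly_smult ac_simps)
    have "(of_int (coeff q 0) :: rat) = of_int e"
      using arg_cong[OF e(2), of "\<lambda>p. coeff p 0"] Q0 by (simp add: coeff_map_poly)
    then show "coeff (Polynomial.smult d q) 0 \<noteq> 0" using d e by simp
  qed
qed

section \<open>The generating function and its symmetry\<close>

lemma fps_n_power: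
  fixes c :: "'a :: field"
  shows "Abs_fps (\<lambda>n. of_nat n * c ^ n) * fps_of_poly ([:1, - c:] ^ 2) = fps_of_poly [:0, c:]"
proof (rule fps_ext)
  fix n
  let ?G = "Abs_fps (\<lambda>n. of_nat n * c ^ n)"
  have "fps_of_poly ([:1, - c:] ^ 2) = 1 + fps_const (- 2 * c) * fps_X + fps_const (c ^ 2) * (fps_X * fps_X)"
    by (simp add: power2_eq_square fps_of_poly_pCons algebra_simps)
  then have "?G * fps_of_poly ([:1, - c:] ^ 2)
      = ?G + fps_const (- 2 * c) * (?G * fps_X) + fps_const (c ^ 2) * (?G * fps_X * fps_X)"
    by (simp only: distrib_left mult_1_left mult_1_right ac_simps)
  moreover have "fps_nth (?G + fps_const (- 2 * c) * (?G * fps_X) + fps_const (c ^ 2) * (?G * fps_X * fps_X)) n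
      = coeff [:0, c:] n"
  proof -
    consider "n = 0" | "n = 1" | m where "n = Suc (Suc m)" by (metis One_nat_def not0_implies_Suc)
    then show ?thesis
      by cases (simp_all add: mult.assoc algebra_simps power2_eq_square)
  qed
  ultimately show "fps_nth (?G * fps_of_poly ([:1, - c:] ^ 2)) n = fps_nth (fps_of_poly [:0, c:]) n"
    by simp
qed

text \<open>
  Multiplying out, the product becomes a sum over subsets \<open>S\<close> of the terms \<open>c S * l S ^ n\<close>, and \<open>n\<close>
  times such a term has the generating function \<open>c S * (l S * z) / (1 - l S * z)\<^sup>2\<close>. That function is
  unchanged when \<open>z\<close> and \<open>l S\<close> are both inverted. Passing to the complement of \<open>S\<close> inverts \<open>l S\<close>,
  because all \<open>u i\<close> multiply to 1, and keeps \<open>c S\<close>, because all \<open>\<epsilon> i\<close> multiply to 1 and are signs.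
  Hence the sum \<open>r\<close> of all these functions satisfies \<open>r (1 / z) = r z\<close>. It is kept as a function, valid
  away from the zeros of \<open>Q\<close>.
\<close>

lemma signed_power_prod_gf:
  fixes u \<epsilon> :: "'i \<Rightarrow> complex" and C :: complex
  assumes fin: "finite I" and u: "(\<Prod>i\<in>I. u i) = 1" and e: "(\<Prod>i\<in>I. \<epsilon> i) = 1"
    and sign: "\<And>i. \<epsilon> i = 1 \<or> \<epsilon> i = - 1"
  obtains P Q :: "complex poly" and r :: "complex \<Rightarrow> complex"
  where "Abs_fps (\<lambda>n. C * of_nat n * (\<Prod>i\<in>I. u i ^ n + \<epsilon> i)) * fps_of_poly Q = fps_of_poly P"
    "coeff Q 0 = 1" "\<And>z. poly Q z \<noteq> 0 \<Longrightarrow> poly P z = r z * poly Q z" "\<And>z. z \<noteq> 0 \<Longrightarrow> r (1 / z) = r z"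
proof -
  define l where "l S = (\<Prod>i\<in>S. u i)" for S
  define c where "c S = C * (\<Prod>i\<in>I - S. \<epsilon> i)" for S
  define D where "D S = [:1, - l S:] ^ 2" for S
  define Q where "Q = (\<Prod>S\<in>Pow I. D S)"
  define P where "P = (\<Sum>S\<in>Pow I. [:c S:] * [:0, l S:] * (\<Prod>T\<in>Pow I - {S}. D T))"
  define r where "r z = (\<Sum>S\<in>Pow I. c S * (l S * z) / (1 - l S * z) ^ 2)" for z
  have finP: "finite (Pow I)" using fin by simp
  have Q: "Q = D S * (\<Prod>T\<in>Pow I - {S}. D T)" if "S \<in> Pow I" for S
    unfolding Q_def by (rule prod.remove[OF finP that])
  let ?F = "Abs_fps (\<lambda>n. C * of_nat n * (\<Prod>i\<in>I. u i ^ n + \<epsilon> i))"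
  let ?G = "\<lambda>S. Abs_fps (\<lambda>n. of_nat n * l S ^ n)"
  have F: "?F = (\<Sum>S\<in>Pow I. fps_const (c S) * ?G S)"
  proof (rule fps_ext)
    fix n
    have "fps_nth ?F n = C * of_nat n * (\<Sum>S\<in>Pow I. l S ^ n * (\<Prod>i\<in>I - S. \<epsilon> i))"
      unfolding l_def by (simp add: prod_add[OF fin] prod_power_distrib)
    then show "fps_nth ?F n = fps_nth (\<Sum>S\<in>Pow I. fps_const (c S) * ?G S) n"
      by (simp add: fps_sum_nth sum_distrib_left c_def ac_simps)
  qed
  have "?F * fps_of_poly Q = (\<Sum>S\<in>Pow I. fps_const (c S) * ?G S * fps_of_poly Q)"
    unfolding F by (rule sum_distrib_right)
  also have "\<dots> = (\<Sum>S\<in>Pow I. fps_of_poly ([:c S:] * [:0, l S:] * (\<Prod>T\<in>Pow I - {S}. D T)))"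
  proof (rule sum.cong[OF refl])
    fix S assume S: "S \<in> Pow I"
    have "fps_const (c S) * ?G S * fps_of_poly Q
        = fps_const (c S) * (?G S * fps_of_poly (D S)) * fps_of_poly (\<Prod>T\<in>Pow I - {S}. D T)"
      unfolding Q[OF S] fps_of_poly_mult by (simp only: mult.assoc)
    also have "\<dots> = fps_of_poly ([:c S:] * [:0, l S:] * (\<Prod>T\<in>Pow I - {S}. D T))"
      unfolding D_def fps_n_power fps_of_poly_mult fps_of_poly_const ..
    finally show "fps_const (c S) * ?G S * fps_of_poly Q = fps_of_poly ([:c S:] * [:0, l S:] * (\<Prod>T\<in>Pow I - {S}. D T))" .
  qed
  also have "\<dots> = fps_of_poly P" unfolding P_def fps_of_poly_sum ..
  finally have eq: "?F * fps_of_poly Q = fps_of_poly P" .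
  have "coeff Q 0 = 1"
    unfolding Q_def D_def poly_0_coeff_0[symmetric] by (simp add: poly_prod)
  moreover have "poly P z = r z * poly Q z" if nz: "poly Q z \<noteq> 0" for z
    unfolding P_def r_def poly_sum sum_distrib_right
  proof (rule sum.cong[OF refl])
    fix S assume S: "S \<in> Pow I"
    have q: "poly Q z = (1 - l S * z) ^ 2 * poly (\<Prod>T\<in>Pow I - {S}. D T) z"
      unfolding Q[OF S] by (simp add: D_def mult.commute)
    with nz have "(1 - l S * z) ^ 2 \<noteq> 0" by auto
    then show "poly ([:c S:] * [:0, l S:] * (\<Prod>T\<in>Pow I - {S}. D T)) z
        = c S * (l S * z) / (1 - l S * z) ^ 2 * poly Q z"
      unfolding q by (simp add: mult.commute)
  qed
  moreover have "r (1 / z) = r z" if z: "z \<noteq> 0" for z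
  proof -
    have compl: "l (I - S) = inverse (l S)" "c (I - S) = c S" "l S \<noteq> 0" if S: "S \<in> Pow I" for S
    proof -
      have "l S * l (I - S) = 1"
        using prod.subset_diff[of S I u] S fin u unfolding l_def by (simp add: mult.commute)
      then show "l S \<noteq> 0" "l (I - S) = inverse (l S)"
        using inverse_unique[of "l S" "l (I - S)"] by auto
      have sq: "(\<Prod>i\<in>S. \<epsilon> i) * (\<Prod>i\<in>S. \<epsilon> i) = 1"
        unfolding prod.distrib[symmetric]
      proof (intro prod.neutral ballI)
        fix i
        show "\<epsilon> i * \<epsilon> i = 1" using sign[of i] by auto
      qed
      have "(\<Prod>i\<in>I - S. \<epsilon> i) * (\<Prod>i\<in>S. \<epsilon> i) = 1"
        using prod.subset_diff[of S I \<epsilon>] S fin e by simp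
      then have "(\<Prod>i\<in>I - S. \<epsilon> i) = (\<Prod>i\<in>S. \<epsilon> i)"
        using sq by (metis mult.assoc mult.left_neutral mult.right_neutral)
      moreover have "I - (I - S) = S" using S by auto
      ultimately show "c (I - S) = c S" unfolding c_def by simp
    qed
    have bij: "bij_betw (\<lambda>S. I - S) (Pow I) (Pow I)"
      by (rule bij_betw_byWitness[where f' = "\<lambda>S. I - S"]) auto
    have "r (1 / z) = (\<Sum>S\<in>Pow I. c (I - S) * (l (I - S) * (1 / z)) / (1 - l (I - S) * (1 / z)) ^ 2)"
      unfolding r_def by (rule sum.reindex_bij_betw[OF bij, symmetric])
    also have "\<dots> = r z"
      unfolding r_def
    proof (rule sum.cong[OF refl])
      fix S assume S: "S \<in> Pow I"
      have "inverse a * (1 / z) / (1 - inverse a * (1 / z)) ^ 2 = a * z / (1 - a * z) ^ 2" if "a \<noteq> 0" for a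
      proof -
        let ?w = "a * z"
        have w: "?w \<noteq> 0" using that z by simp
        have "1 - inverse ?w = (?w - 1) / ?w" using w by (simp add: diff_divide_distrib inverse_eq_divide)
        then have "(1 - inverse ?w) ^ 2 = (1 - ?w) ^ 2 / ?w ^ 2"
          by (simp only: power_divide power2_commute[of ?w])
        then have "inverse ?w / (1 - inverse ?w) ^ 2 = ?w / (1 - ?w) ^ 2"
          using w by (simp add: power2_eq_square divide_simps)
        then show ?thesis by (simp add: divide_inverse)
      qed
      from this[OF compl(3)[OF S]]
      show "c (I - S) * (l (I - S) * (1 / z)) / (1 - l (I - S) * (1 / z)) ^ 2
          = c S * (l S * z) / (1 - l S * z) ^ 2"
        unfolding compl(1,2)[OF S] times_divide_eq_right[symmetric] by simp
    qed
    finally show ?thesis .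
  qed
  ultimately show thesis by (rule that[OF eq])
qed

section \<open>Substituting the inverse of the indeterminate\<close>

lemma of_int_eq_to_fract: "(of_int a :: int poly fract) = to_fract [:a:]"
proof -
  have nat: "to_fract (of_nat n) = (of_nat n :: int poly fract)" for n
    by (induction n) simp_all
  have "to_fract (of_int a) = (of_int a :: int poly fract)"
    by (cases a rule: int_cases2) (simp_all add: nat)
  then show ?thesis by (simp add: of_int_poly)
qed

lemma to_fract_power: "to_fract (x ^ n) = to_fract x ^ n"
  by (induction n) simp_all

lemma ratfun_X_eq: "ratfun_X = to_fract [:0, 1:]"
  by (simp add: ratfun_X_def to_fract_def)

lemma ratfun_X_nonzero: "ratfun_X \<noteq> 0"
  unfolding ratfun_X_eq by simp

lemma poly_at_ratfun_X: "poly (map_poly of_int p) ratfun_X = to_fract p"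
proof (induction p)
  case (pCons a p)
  have "to_fract (pCons a p) = to_fract ([:a:] + [:0, 1:] * p)" by simp
  also have "\<dots> = of_int a + ratfun_X * to_fract p"
    unfolding to_fract_add to_fract_mult of_int_eq_to_fract ratfun_X_eq ..
  finally show ?case using pCons by (simp add: map_poly_pCons)
qed simp

lemma poly_at_inverse_ratfun_X:
  "poly (map_poly of_int p) (1 / ratfun_X) = to_fract (reflect_poly p) / ratfun_X ^ degree p"
proof -
  let ?p = "map_poly of_int p :: int poly fract poly"
  have deg: "degree ?p = degree p"
    by (rule degree_map_poly) (simp add: of_int_eq_to_fract)
  have "reflect_poly ?p = map_poly of_int (reflect_poly p)"
    by (rule poly_eqI) (simp add: coeff_reflect_poly coeff_map_poly deg)
  then have "to_fract (reflect_poly p) = ratfun_X ^ degree p * poly ?p (inverse ratfun_X)"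
    using poly_reflect_poly_nz[OF ratfun_X_nonzero, of ?p] by (simp add: poly_at_ratfun_X deg)
  then show ?thesis using ratfun_X_nonzero by (simp add: inverse_eq_divide)
qed

text \<open>
  After clearing powers of the indeterminate, the claim is an identity between integer polynomials,
  with reflected polynomials in place of the values at \<open>1 / ratfun_X\<close>. It can be tested at all but
  finitely many complex numbers.
\<close>

lemma ratfun_at_inverse_eqI:
  fixes P Q :: "int poly"
  assumes "Q \<noteq> 0" "finite B"
    and eq: "\<And>z :: complex. z \<noteq> 0 \<Longrightarrow> z \<notin> B \<Longrightarrow>
      poly (map_poly of_int P) z * poly (map_poly of_int Q) (1 / z)
        = poly (map_poly of_int P) (1 / z) * poly (map_poly of_int Q) z"
  shows "ratfun_at P Q ratfun_X = ratfun_at P Q (1 / ratfun_X)"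
proof -
  let ?X = "[:0, 1:] :: int poly"
  let ?L = "P * reflect_poly Q * ?X ^ degree P" and ?R = "reflect_poly P * Q * ?X ^ degree Q"
  let ?e = "\<lambda>p z. poly (map_poly of_int p) z :: complex"
  have refl: "?e (reflect_poly p) z = z ^ degree p * ?e p (1 / z)" if "z \<noteq> 0" for p :: "int poly" and z
  proof -
    have "reflect_poly (map_poly of_int p) = (map_poly of_int (reflect_poly p) :: complex poly)"
      by (rule poly_eqI) (simp add: coeff_reflect_poly coeff_map_poly)
    then show ?thesis using poly_reflect_poly_nz[OF that, of "map_poly of_int p"]
      by (simp add: inverse_eq_divide)
  qed
  have ev: "?e ?L z = ?e ?R z" if "z \<notin> insert 0 B" for z
  proof -
    have z: "z \<noteq> 0" using that by simp
    have "?e ?L z = z ^ degree P * z ^ degree Q * (?e P z * ?e Q (1 / z))"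
      by (simp add: hom_distribs refl[OF z] map_poly_pCons)
    also have "\<dots> = ?e ?R z"
      using eq[OF z] that by (simp add: hom_distribs refl[OF z] map_poly_pCons)
    finally show ?thesis .
  qed
  have "map_poly of_int ?L = (map_poly of_int ?R :: complex poly)"
  proof (rule ccontr)
    assume "map_poly of_int ?L \<noteq> (map_poly of_int ?R :: complex poly)"
    then have "finite {z. poly (map_poly of_int ?L - map_poly of_int ?R) z = (0 :: complex)}"
      by (intro poly_roots_finite) simp
    moreover have "- insert 0 B \<subseteq> {z. poly (map_poly of_int ?L - map_poly of_int ?R) z = 0}"
      using ev by auto
    ultimately have "finite (- insert 0 B)" by (rule rev_finite_subset)
    then have "finite (UNIV :: complex set)" using assms(2) by simp
    then show False using infinite_UNIV_char_0 by blast
  qed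
  then have "?L = ?R" by (simp only: of_int_poly_hom.eq_iff)
  then have "to_fract P * to_fract (reflect_poly Q) * ratfun_X ^ degree P
      = to_fract (reflect_poly P) * to_fract Q * ratfun_X ^ degree Q"
    unfolding ratfun_X_eq by (metis to_fract_mult to_fract_power)
  then show ?thesis
    unfolding ratfun_at_def poly_at_ratfun_X poly_at_inverse_ratfun_X
    using assms(1) ratfun_X_nonzero by (simp add: divide_simps) (simp add: ac_simps)
qed

section \<open>Rationality and symmetry of the generating function\<close>

theorem theorem6:
  fixes k :: nat and s :: "nat \<Rightarrow> nat"
  assumes "k \<ge> 1"
    and "s 1 \<ge> 1"
    and "strict_mono_on {1..k} s"
    and "Gcd (s ` {1..k}) = 1"
  shows "\<exists>P Q :: int poly. coeff Q 0 \<noteq> 0 \<and> tau_gf k s = expansion_at_0 P Q \<and>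
           ratfun_at P Q ratfun_X = ratfun_at P Q (1 / ratfun_X)"
proof -
  define t :: "nat \<Rightarrow> rat" where "t n = (if n = 0 then 0 else of_nat (tau k s n))" for n
  have gf: "tau_gf k s = Abs_fps t" unfolding tau_gf_def t_def ..
  obtain C :: complex and u \<epsilon> :: "nat + nat \<Rightarrow> complex" and I
    where I: "finite I" "(\<Prod>i\<in>I. u i) = 1" "(\<Prod>i\<in>I. \<epsilon> i) = 1" "\<And>i. \<epsilon> i = 1 \<or> \<epsilon> i = - 1"
      and tau: "\<And>n. n \<ge> 1 \<Longrightarrow> of_nat (tau k s n) = C * of_nat n * (\<Prod>i\<in>I. u i ^ n + \<epsilon> i)"
    by (rule tau_closed_form[OF assms(1-3)]) (rule that)
  have t: "of_rat (t n) = C * of_nat n * (\<Prod>i\<in>I. u i ^ n + \<epsilon> i)" for n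
    using tau[of n] by (cases "n = 0") (simp_all add: t_def)
  let ?F = "Abs_fps (\<lambda>n. of_rat (t n)) :: complex fps"
  have F: "?F = Abs_fps (\<lambda>n. C * of_nat n * (\<Prod>i\<in>I. u i ^ n + \<epsilon> i))" by (simp only: t)
  obtain P Q r where F_Q: "Abs_fps (\<lambda>n. C * of_nat n * (\<Prod>i\<in>I. u i ^ n + \<epsilon> i)) * fps_of_poly Q = fps_of_poly P"
    and Q0: "coeff Q 0 = 1"
    and r: "\<And>z. poly Q z \<noteq> 0 \<Longrightarrow> poly P z = r z * poly Q z"
    and r_inv: "\<And>z. z \<noteq> 0 \<Longrightarrow> r (1 / z) = r z"
    by (rule signed_power_prod_gf[OF I, of C]) (rule that)
  note F_Q = F_Q[folded F]
  obtain P' Q' :: "rat poly" where "Abs_fps t * fps_of_poly Q' = fps_of_poly P'" "coeff Q' 0 = 1"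
    by (rule rational_series_descent[OF F_Q Q0])
  then obtain p q :: "int poly"
    where pq: "Abs_fps t * fps_of_poly (map_poly of_int q) = fps_of_poly (map_poly of_int p)" "coeff q 0 \<noteq> 0"
    by (rule int_polys_of_rat_polys)
  let ?p = "map_poly of_int p :: complex poly" and ?q = "map_poly of_int q :: complex poly"
  have "fps_of_poly (map_poly of_int q) \<noteq> (0 :: rat fps)"
  proof
    assume "fps_of_poly (map_poly of_int q) = (0 :: rat fps)"
    then have "fps_nth (fps_of_poly (map_poly of_int q)) 0 = (0 :: rat)" by simp
    then show False using pq(2) by (simp add: coeff_map_poly)
  qed
  then have expansion: "tau_gf k s = expansion_at_0 p q"
    unfolding gf expansion_at_0_def pq(1)[symmetric] by simp
  have "?F * fps_of_poly ?q = fps_of_poly ?p"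
  proof (rule fps_ext)
    fix n
    have "of_rat (fps_nth (Abs_fps t * fps_of_poly (map_poly of_int q)) n)
        = (of_rat (fps_nth (fps_of_poly (map_poly of_int p)) n) :: complex)"
      unfolding pq(1) ..
    then show "fps_nth (?F * fps_of_poly ?q) n = fps_nth (fps_of_poly ?p) n"
      by (simp add: fps_mult_nth coeff_map_poly of_rat_sum of_rat_mult)
  qed
  then have "fps_of_poly (?p * Q) = fps_of_poly (P * ?q)"
    unfolding fps_of_poly_mult F_Q[symmetric] by (metis mult.assoc mult.commute)
  then have cross: "?p * Q = P * ?q" by (simp only: fps_of_poly_eq_iff)
  \<comment> \<open>The descended fraction takes the same values as \<open>r\<close>, wherever the latter is meaningful, and
      therefore inherits its symmetry.\<close>
  have quot: "poly ?p z = r z * poly ?q z" if "poly Q z \<noteq> 0" for z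
  proof -
    have "poly ?p z * poly Q z = r z * poly ?q z * poly Q z"
      using arg_cong[OF cross, of "\<lambda>p. poly p z"] r[OF that] by (simp add: ac_simps)
    then show ?thesis using that by simp
  qed
  let ?B = "{z. poly Q z = 0} \<union> (\<lambda>w. 1 / w) ` {z. poly Q z = 0}"
  have "Q \<noteq> 0" using Q0 by auto
  then have "finite ?B" using poly_roots_finite by blast
  moreover have "poly ?p z * poly ?q (1 / z) = poly ?p (1 / z) * poly ?q z" if z: "z \<noteq> 0" "z \<notin> ?B" for z
  proof -
    have "poly Q z \<noteq> 0" using z(2) by simp
    moreover have "poly Q (1 / z) \<noteq> 0"
    proof
      assume "poly Q (1 / z) = 0"
      then have "1 / (1 / z) \<in> (\<lambda>w. 1 / w) ` {z. poly Q z = 0}" by (intro imageI) simp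
      then show False using z(2) by simp
    qed
    ultimately show ?thesis using quot r_inv[OF z(1)] by simp
  qed
  moreover have "q \<noteq> 0" using pq(2) by auto
  ultimately have "ratfun_at p q ratfun_X = ratfun_at p q (1 / ratfun_X)"
    by (intro ratfun_at_inverse_eqI[of q ?B p]) blast+
  with expansion pq(2) show ?thesis by blast
qed

end
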